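(* Let $w$ be a finite prime of $F$, $K$ the completion of $F$ at $w$, and $\phi$ a rank $r$ Drinfeld $A$-module over $K$ with stable reduction whose reduction has rank $r'$, $1\le r'<r$, with Tate uniformization $(\psi,\Lambda,e_\phi)$. Let $u$ be a finite prime of $A$ and $n$ a positive integer. Let $\{\omega_i\}_{i=1,\ldots,r'}$ be an SMB of $\psi[u^n]$, let $\{\omega_i^0\}_{i=r'+1,\ldots,r}$ be an SMB of $\Lambda$, and for $i=r'+1,\ldots,r$ let $\omega_i$ be a root of $\psi_{u^n}(X)-\omega_i^0$. Then $\{e_\phi(\omega_i)\}_{i=1,\ldots,r}$ is an SMB of $\phi[u^n]$.
   Context: $q$ a power of a prime $p$, $A=\mathbb{F}_q[t]$, $F$ a finite extension of $\mathbb{F}_q(t)$; a finite prime of $F$ is one not lying over $1/t$. $K$ is the completion at $w$, $w$ its normalized valuation ($w(K^\times)=\mathbb{Z}$) extended to $K^{\mathrm{sep}}$ and to the completion $\mathbb{C}_w$ of an algebraic closure. A rank $r$ Drinfeld module over $K$: $\phi_t(X)=tX+a_1X^q+\cdots+a_rX^{q^r}$, $a_r\ne0$; $a\cdot_\phi x=\phi_a(x)$. $\phi$ has stable reduction with reduction of rank $r'$ if all $a_i$ lie in the valuation ring, $a_{r'}$ is a unit and $w(a_i)>0$ for $i>r'$; good reduction means $r'=r$. For a Drinfeld module $\rho$ of rank $s$ and a monic irreducible $u\in A$, $\rho[u^n]$ is the $A/u^n$-module of roots of $\rho_{u^n}(X)$ in $K^{\mathrm{sep}}$, and an SMB of $\rho[u^n]$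 is a family $\{\lambda_i\}_{i=1}^s\subset\rho[u^n]$ such that for each $i$, $\lambda_1,\dots,\lambda_i$ are $A/u^n$-linearly independent and $w(\lambda_i)$ is largest among $w(\lambda)$, $\lambda\in\rho[u^n]$ with $\lambda_1,\dots,\lambda_{i-1},\lambda$ $A/u^n$-linearly independent. Tate uniformization: a rank $r'$ Drinfeld module $\psi$ over $K$ with good reduction, an $A$-lattice $\Lambda\subset\mathbb{C}_w$ of rank $r-r'$ for the action $a\cdot_\psi z=\psi_a(z)$, stable under $\mathrm{Gal}(K^{\mathrm{sep}}/K)$, all of whose nonzero elements have negative valuation, and the surjective entire map $e_\phi(z)=z\prod_{\mu\in\Lambda\setminus\{0\}}(1-z/\mu)$ with kernel $\Lambda$ and $e_\phi(\psi_a(z))=\phi_a(e_\phi(z))$. Define $|x|=(-w(x))^{1/r'}$ if $w(x)<0$, $|x|=-(w(x))^{1/r'}$ if $w(x)\ge0$, $|0|=-\infty$. An SMB of $\Lambda$ is a family $\{\omega_i^0\}_{i=r'+1}^r\subset\Lambda$ such that for each $i$, $\omega^0_{r'+1},\dots,\omega^0_i$ are $A$-linearly independent (for $\cdot_\psi$) and $|\omega^0_i|$ is minimal among $|\omega|$, $\omega\in\Lambda$ with $\omega^0_{r'+1},\dots,\omega^0_{i-1},\omega$ $A$-linearly independent. *)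

theory Defs
  imports "HOL-Analysis.Analysis" "HOL-Computational_Algebra.Computational_Algebra"
begin

text \<open>
  The type \<open>'k\<close> is the finite field with \<open>q = CARD('k)\<close> elements, \<open>'k poly\<close> is \<open>A\<close> and
  \<open>'k poly fract\<close> is its fraction field. All other fields are subfields of one algebraically
  closed field \<open>'c\<close>, which plays the role of the completed algebraic closure; the fraction field
  of \<open>A\<close> is embedded into it by a field homomorphism \<open>h\<close>.
\<close>

section \<open>Valued fields\<close>

definition is_subfield :: "'c::field set \<Rightarrow> bool" where
  "is_subfield S \<longleftrightarrow> 0 \<in> S \<and> 1 \<in> S \<and>
     (\<forall>x\<in>S. \<forall>y\<in>S. x + y \<in> S \<and> x * y \<in> S) \<and> (\<forall>x\<in>S. - x \<in> S \<and> inverse x \<in> S)"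

definition is_field_hom :: "('a::field \<Rightarrow> 'b::field) \<Rightarrow> bool" where
  "is_field_hom f \<longleftrightarrow> f 1 = 1 \<and> (\<forall>x y. f (x + y) = f x + f y \<and> f (x * y) = f x * f y)"

definition is_valuation :: "('c::field \<Rightarrow> ereal) \<Rightarrow> bool" where
  "is_valuation w \<longleftrightarrow>
     (\<forall>x. w x \<noteq> - \<infinity>) \<and> (\<forall>x. w x = \<infinity> \<longleftrightarrow> x = 0) \<and>
     (\<forall>x y. w (x * y) = w x + w y) \<and> (\<forall>x y. min (w x) (w y) \<le> w (x + y))"

definition val_dist :: "('c::field \<Rightarrow> ereal) \<Rightarrow> 'c \<Rightarrow> 'c \<Rightarrow> real" where
  "val_dist w x y = (if x = y then 0 else 2 powr (- real_of_ereal (w (x - y))))"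

lemma Metric_space_val_dist:
  assumes "is_valuation w"
  shows "Metric_space UNIV (val_dist w)"
proof -
  have mult: "w (x * y) = w x + w y" and ninf: "w x \<noteq> - \<infinity>"
    and inf: "w x = \<infinity> \<longleftrightarrow> x = 0" and ultra: "min (w x) (w y) \<le> w (x + y)" for x y
    using assms by (auto simp: is_valuation_def)
  have fin: "\<exists>r. w x = ereal r" if "x \<noteq> 0" for x
    using ninf[of x] inf[of x] that by (cases "w x") auto
  obtain a where a: "w 1 = ereal a" using fin[of 1] by auto
  obtain b where b: "w (-1) = ereal b" using fin[of "-1"] by auto
  have "a = 0" using mult[of 1 1] a by simp
  then have "b = 0" using mult[of "-1" "-1"] a b by simp
  then have neg: "w (- x) = w x" for x
    using mult[of "-1" x] b by (simp flip: zero_ereal_def)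
  have sym: "val_dist w x y = val_dist w y x" for x y
    using neg[of "x - y"] by (auto simp: val_dist_def)
  have nonneg: "0 \<le> val_dist w x y" for x y
    by (simp add: val_dist_def)
  have tri: "val_dist w x z \<le> val_dist w x y + val_dist w y z" for x y z
  proof (cases "x = y \<or> y = z \<or> x = z")
    case True
    then show ?thesis using nonneg[of x y] nonneg[of y z] by (auto simp: val_dist_def)
  next
    case False
    then obtain r s m where
      e: "w (x - y) = ereal r" "w (y - z) = ereal s" "w (x - z) = ereal m"
      using fin[of "x - y"] fin[of "y - z"] fin[of "x - z"] by auto
    then have "min r s \<le> m"
      using ultra[of "x - y" "y - z"] by (simp add: min_def split: if_splits)
    then have "2 powr (- m) \<le> 2 powr (- r) \<or> 2 powr (- m) \<le> 2 powr (- s)"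
      by (auto simp: min_def split: if_splits)
    moreover have "0 < 2 powr (- r)" "0 < 2 powr (- s)" by auto
    ultimately have "2 powr (- m) \<le> 2 powr (- r) + 2 powr (- s)" by linarith
    then show ?thesis using False e by (simp add: val_dist_def)
  qed
  have zero: "val_dist w x y = 0 \<longleftrightarrow> x = y" for x y
    by (simp add: val_dist_def)
  show ?thesis
    by unfold_locales (rule nonneg sym zero tri)+
qed

abbreviation val_top :: "('c::field \<Rightarrow> ereal) \<Rightarrow> 'c topology" where
  "val_top w \<equiv> Metric_space.mtopology UNIV (val_dist w)"

definition alg_clos :: "'c::field set \<Rightarrow> 'c set" where
  "alg_clos K = {x. \<exists>p. p \<noteq> 0 \<and> (\<forall>i. coeff p i \<in> K) \<and> poly p x = 0}"

text \<open>Over an algebraically closed \<open>'c\<close>, the condition \<open>rsquarefree p\<close> says that \<open>p\<close> has no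
  multiple root in an algebraic closure, i.e. that \<open>p\<close> is separable.\<close>

definition sep_clos :: "'c::alg_closed_field set \<Rightarrow> 'c set" where
  "sep_clos K = {x. \<exists>p. rsquarefree p \<and> (\<forall>i. coeff p i \<in> K) \<and> poly p x = 0}"

definition galois_group :: "'c::alg_closed_field set \<Rightarrow> ('c \<Rightarrow> 'c) set" where
  "galois_group K = {g. bij_betw g (sep_clos K) (sep_clos K) \<and> (\<forall>x\<in>K. g x = x) \<and>
     (\<forall>x\<in>sep_clos K. \<forall>y\<in>sep_clos K. g (x + y) = g x + g y \<and> g (x * y) = g x * g y)}"

text \<open>The Galois group acts on \<open>'c\<close> through the continuous extensions of its elements.\<close>

definition galois_stable :: "('c::alg_closed_field \<Rightarrow> ereal) \<Rightarrow> 'c set \<Rightarrow> 'c set \<Rightarrow> bool" where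
  "galois_stable w K L \<longleftrightarrow>
     (\<forall>g\<in>galois_group K. \<forall>\<sigma>. continuous_map (val_top w) (val_top w) \<sigma> \<and>
        (\<forall>x\<in>sep_clos K. \<sigma> x = g x) \<longrightarrow> \<sigma> ` L \<subseteq> L)"

definition is_entire :: "('c::field \<Rightarrow> ereal) \<Rightarrow> ('c \<Rightarrow> 'c) \<Rightarrow> bool" where
  "is_entire w f \<longleftrightarrow>
     (\<exists>c. \<forall>z. limitin (val_top w) (\<lambda>N. \<Sum>i<N. c i * z ^ i) (f z) sequentially)"

abbreviation t_elem :: "('k::field poly fract \<Rightarrow> 'c::field) \<Rightarrow> 'c" where
  "t_elem h \<equiv> h (to_fract [:0, 1:])"

text \<open>
  \<open>F\<close> is a finite extension of the rational function field, \<open>w\<close> restricted to \<open>F\<close> is a prime not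
  lying over \<open>1/t\<close>, \<open>K\<close> is the completion of \<open>F\<close> and \<open>'c\<close> is the completion of the
  algebraic closure of \<open>K\<close>, all with valuation \<open>w\<close>.
\<close>

locale completion_at_finite_prime =
  fixes h :: "'k::{field,finite} poly fract \<Rightarrow> 'c::alg_closed_field"
    and w :: "'c \<Rightarrow> ereal"
    and F K :: "'c set"
  assumes hom: "is_field_hom h"
    and subfield: "is_subfield F" and base: "range h \<subseteq> F"
    and finite_ext: "\<exists>B. finite B \<and> F = module.span (\<lambda>c x. h c * x) B"
    and valuation: "is_valuation w"
    and normalized: "w ` (K - {0}) = range (\<lambda>m::int. ereal (of_int m))"
    and finite_prime: "0 \<le> w (t_elem h)"
    and completion: "K = val_top w closure_of F"
    and complete: "Metric_space.mcomplete UNIV (val_dist w)"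
    and alg_dense: "val_top w closure_of alg_clos K = UNIV"

section \<open>Drinfeld modules\<close>

text \<open>A Drinfeld module is represented by its polynomial \<open>\<phi>\<^sub>t(X)\<close>.\<close>

definition drinfeld_module ::
    "('k::{field,finite} poly fract \<Rightarrow> 'c::field) \<Rightarrow> 'c set \<Rightarrow> nat \<Rightarrow> 'c poly \<Rightarrow> bool" where
  "drinfeld_module h K r \<phi> \<longleftrightarrow> 1 \<le> r \<and>
     (\<exists>a. (\<forall>i\<in>{1..r}. a i \<in> K) \<and> a r \<noteq> 0 \<and>
        \<phi> = monom (t_elem h) 1 + (\<Sum>i=1..r. monom (a i) (CARD('k) ^ i)))"

text \<open>\<open>\<phi>\<^sub>a(X)\<close> for \<open>a = \<Sum> c\<^sub>i t\<^sup>i\<close> is \<open>\<Sum> c\<^sub>i \<phi>\<^sub>t\<^sup>i(X)\<close> with compositional powers.\<close>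

definition drinfeld_poly ::
    "('k::field poly fract \<Rightarrow> 'c::field) \<Rightarrow> 'c poly \<Rightarrow> 'k poly \<Rightarrow> 'c poly" where
  "drinfeld_poly h \<phi> a =
     (\<Sum>i\<le>degree a. smult (h (to_fract [:coeff a i:])) ((pcompose \<phi> ^^ i) [:0, 1:]))"

abbreviation drinfeld_act ::
    "('k::field poly fract \<Rightarrow> 'c::field) \<Rightarrow> 'c poly \<Rightarrow> 'k poly \<Rightarrow> 'c \<Rightarrow> 'c" where
  "drinfeld_act h \<phi> a x \<equiv> poly (drinfeld_poly h \<phi> a) x"

definition stable_reduction :: "nat \<Rightarrow> ('c::field \<Rightarrow> ereal) \<Rightarrow> nat \<Rightarrow> 'c poly \<Rightarrow> nat \<Rightarrow> bool" where
  "stable_reduction q w r \<phi> r' \<longleftrightarrow> r' \<le> r \<and>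
     (\<forall>i\<in>{1..r}. 0 \<le> w (coeff \<phi> (q ^ i))) \<and> w (coeff \<phi> (q ^ r')) = 0 \<and>
     (\<forall>i\<in>{1..r}. r' < i \<longrightarrow> 0 < w (coeff \<phi> (q ^ i)))"

definition good_reduction :: "nat \<Rightarrow> ('c::field \<Rightarrow> ereal) \<Rightarrow> nat \<Rightarrow> 'c poly \<Rightarrow> bool" where
  "good_reduction q w r \<phi> \<longleftrightarrow> stable_reduction q w r \<phi> r"

text \<open>Linear independence over \<open>A/m\<close> of a family in a module killed by \<open>m\<close>; for \<open>m = 0\<close> this is
  linear independence over \<open>A\<close>.\<close>

definition lin_indep_mod ::
    "('k::field poly fract \<Rightarrow> 'c::field) \<Rightarrow> 'c poly \<Rightarrow> 'k poly \<Rightarrow> nat set \<Rightarrow> (nat \<Rightarrow> 'c) \<Rightarrow> bool"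
  where
  "lin_indep_mod h \<rho> m I x \<longleftrightarrow>
     (\<forall>a. (\<Sum>i\<in>I. drinfeld_act h \<rho> (a i) (x i)) = 0 \<longrightarrow> (\<forall>i\<in>I. m dvd a i))"

abbreviation lin_indep ::
    "('k::field poly fract \<Rightarrow> 'c::field) \<Rightarrow> 'c poly \<Rightarrow> nat set \<Rightarrow> (nat \<Rightarrow> 'c) \<Rightarrow> bool" where
  "lin_indep h \<rho> I x \<equiv> lin_indep_mod h \<rho> 0 I x"

definition torsion ::
    "('k::field poly fract \<Rightarrow> 'c::alg_closed_field) \<Rightarrow> 'c set \<Rightarrow> 'c poly \<Rightarrow> 'k poly \<Rightarrow> 'c set" where
  "torsion h K \<rho> m = {x \<in> sep_clos K. drinfeld_act h \<rho> m x = 0}"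

definition torsion_SMB ::
    "('k::field poly fract \<Rightarrow> 'c::alg_closed_field) \<Rightarrow> ('c \<Rightarrow> ereal) \<Rightarrow> 'c set \<Rightarrow> nat \<Rightarrow> 'c poly
     \<Rightarrow> 'k poly \<Rightarrow> (nat \<Rightarrow> 'c) \<Rightarrow> bool" where
  "torsion_SMB h w K s \<rho> m x \<longleftrightarrow>
     (\<forall>i\<in>{1..s}. x i \<in> torsion h K \<rho> m \<and> lin_indep_mod h \<rho> m {1..i} x \<and>
        (\<forall>y\<in>torsion h K \<rho> m. lin_indep_mod h \<rho> m {1..i} (x(i := y)) \<longrightarrow> w y \<le> w (x i)))"

section \<open>Lattices and Tate uniformization\<close>

text \<open>Since \<open>A\<close> is a principal ideal domain, lattices are free; the rank is the size of a basis.
  Discreteness means that every ball contains only finitely many elements.\<close>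

definition A_lattice ::
    "('k::field poly fract \<Rightarrow> 'c::field) \<Rightarrow> ('c \<Rightarrow> ereal) \<Rightarrow> 'c poly \<Rightarrow> nat \<Rightarrow> 'c set \<Rightarrow> bool" where
  "A_lattice h w \<psi> s \<Lambda> \<longleftrightarrow>
     (\<exists>b. lin_indep h \<psi> {1..s} b \<and>
        \<Lambda> = {x. \<exists>a. x = (\<Sum>i=1..s. drinfeld_act h \<psi> (a i) (b i))}) \<and>
     (\<forall>R::real. finite {x \<in> \<Lambda>. ereal R \<le> w x})"

definition lattice_abs :: "('c::field \<Rightarrow> ereal) \<Rightarrow> nat \<Rightarrow> 'c \<Rightarrow> ereal" where
  "lattice_abs w r' x =
     (if x = 0 then - \<infinity>
      else if w x < 0 then ereal ((- real_of_ereal (w x)) powr (1 / real r'))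
      else ereal (- (real_of_ereal (w x) powr (1 / real r'))))"

definition lattice_SMB ::
    "('k::field poly fract \<Rightarrow> 'c::field) \<Rightarrow> ('c \<Rightarrow> ereal) \<Rightarrow> nat \<Rightarrow> nat \<Rightarrow> 'c poly \<Rightarrow> 'c set
     \<Rightarrow> (nat \<Rightarrow> 'c) \<Rightarrow> bool" where
  "lattice_SMB h w r' r \<psi> \<Lambda> x \<longleftrightarrow>
     (\<forall>i\<in>{r'+1..r}. x i \<in> \<Lambda> \<and> lin_indep h \<psi> {r'+1..i} x \<and>
        (\<forall>y\<in>\<Lambda>. lin_indep h \<psi> {r'+1..i} (x(i := y)) \<longrightarrow>
           lattice_abs w r' (x i) \<le> lattice_abs w r' y))"

definition tate_uniformization ::
    "('k::{field,finite} poly fract \<Rightarrow> 'c::alg_closed_field) \<Rightarrow> ('c \<Rightarrow> ereal) \<Rightarrow> 'c set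
     \<Rightarrow> nat \<Rightarrow> nat \<Rightarrow> 'c poly \<Rightarrow> 'c poly \<Rightarrow> 'c set \<Rightarrow> ('c \<Rightarrow> 'c) \<Rightarrow> bool" where
  "tate_uniformization h w K r r' \<phi> \<psi> \<Lambda> e \<longleftrightarrow>
     drinfeld_module h K r' \<psi> \<and> good_reduction CARD('k) w r' \<psi> \<and>
     A_lattice h w \<psi> (r - r') \<Lambda> \<and> galois_stable w K \<Lambda> \<and> (\<forall>\<mu>\<in>\<Lambda> - {0}. w \<mu> < 0) \<and>
     (\<forall>z. limitin (val_top w) (\<lambda>S. z * (\<Prod>\<mu>\<in>S. 1 - z / \<mu>)) (e z)
            (finite_subsets_at_top (\<Lambda> - {0}))) \<and>
     is_entire w e \<and> surj e \<and> {z. e z = 0} = \<Lambda> \<and>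
     (\<forall>a z. e (drinfeld_act h \<psi> a z) = drinfeld_act h \<phi> a (e z))"

end

theory Submission
  imports Defs
begin

text \<open>
  The map \<open>e\<close> is additive with kernel \<open>\<Lambda>\<close>, so \<open>\<phi>[m]\<close>, for \<open>m = u\<^sup>n\<close>, is the quotient by \<open>\<Lambda>\<close> of
  \<open>V = {z. \<psi>\<^sub>m(z) \<in> \<Lambda>}\<close>. Since \<open>\<psi>\<close> has good reduction, \<open>w(\<psi>\<^sub>a(z)) = q\<^bsup>r' deg a\<^esup> w(z)\<close> if \<open>w(z) < 0\<close>,
  whereas \<open>\<psi>\<^sub>a\<close> preserves \<open>w(z) \<ge> 0\<close>. Division with remainder in \<open>A\<close> then shows that successive
  minima of \<open>\<Lambda>\<close> span a saturated submodule, and together with a count of \<open>\<psi>[m]\<close> this shows that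
  the \<open>e(\<omega>\<^sub>i)\<close> are independent modulo \<open>m\<close> and that \<open>w(z) \<le> w(\<omega>\<^sub>i)\<close> for every \<open>z \<in> V\<close> such that
  \<open>e(z)\<close> is independent of \<open>e(\<omega>\<^sub>1), \<dots>, e(\<omega>\<^sub>i\<^sub>-\<^sub>1)\<close>. Choosing \<open>z\<close> of maximal valuation in its coset
  modulo \<open>\<Lambda>\<close>, the product formula for \<open>e\<close> turns this into \<open>w(e(z)) \<le> w(e(\<omega>\<^sub>i))\<close>.
\<close>

section \<open>Finite fields and additive polynomials\<close>

lemma degree_prod_linear: "degree (\<Prod>v\<in>V. [:- v, 1:]) = card V"
  for V :: "'a::idom set"
  by (subst degree_prod_eq_sum_degree) auto

lemma poly_eq_prod_roots:
  fixes p :: "'a::idom poly"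
  assumes "finite V" "lead_coeff p = 1" "degree p = card V" "\<And>v. v \<in> V \<Longrightarrow> poly p v = 0"
  shows "poly p z = (\<Prod>v\<in>V. z - v)"
proof -
  let ?P = "\<Prod>v\<in>V. [:- v, 1:]"
  have "lead_coeff ?P = 1"
    by (simp add: lead_coeff_prod)
  then have "p = ?P"
    using assms degree_prod_linear[of V]
    by (intro poly_eqI_degree_lead_coeff[where n = "card V" and A = V]) (auto simp: poly_prod)
  then show ?thesis
    by (simp add: poly_prod)
qed

text \<open>Translation by \<open>v \<in> V\<close> permutes the roots, so the polynomial takes the same value at \<open>y\<close> and
  at \<open>y + v\<close>; hence \<open>\<Prod>(X + y - v) - \<Prod>(y - v)\<close> is monic with the roots \<open>V\<close>.\<close>

lemma prod_subgroup_diff_add: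
  fixes V :: "'a::field set"
  assumes fin: "finite V" and zero: "0 \<in> V" and diff: "\<And>a b. a \<in> V \<Longrightarrow> b \<in> V \<Longrightarrow> a - b \<in> V"
  shows "(\<Prod>v\<in>V. x + y - v) = (\<Prod>v\<in>V. x - v) + (\<Prod>v\<in>V. y - v)"
proof -
  let ?P = "\<Prod>v\<in>V. [:- v, 1:]"
  let ?Q = "pcompose ?P [:y, 1:]"
  let ?R = "[:- poly ?P y:] + ?Q"
  have card: "0 < card V"
    using fin zero by (auto simp: card_gt_0_iff)
  have deg: "degree ?Q = card V"
    by (simp add: degree_pcompose degree_prod_linear)
  have "poly ?R x = (\<Prod>v\<in>V. x - v)"
  proof (rule poly_eq_prod_roots)
    show "degree ?R = card V"
      using deg card by (subst degree_add_eq_right) auto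
    have "lead_coeff ?Q = 1"
      by (simp add: lead_coeff_comp lead_coeff_prod)
    then show "lead_coeff ?R = 1"
      using deg card by (subst lead_coeff_add_le) auto
  next
    fix v assume v: "v \<in> V"
    have neg: "- a \<in> V" if "a \<in> V" for a
      using diff[OF zero that] by simp
    have add: "a + b \<in> V" if "a \<in> V" "b \<in> V" for a b
      using diff[OF that(1) neg[OF that(2)]] by simp
    have "(\<Prod>a\<in>V. y + v - a) = (\<Prod>a\<in>V. y - a)"
      by (rule prod.reindex_bij_witness[of _ "\<lambda>a. a + v" "\<lambda>a. a - v"])
        (use v add diff in \<open>auto simp: algebra_simps\<close>)
    then show "poly ?R v = 0"
      by (simp add: poly_pcompose poly_prod)
  qed (fact fin)
  then show ?thesis
    by (simp add: poly_pcompose poly_prod algebra_simps)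
qed

lemma finite_field_power_card:
  fixes c :: "'k::{field,finite}"
  shows "c ^ CARD('k) = c"
proof (cases "c = 0")
  case False
  let ?P = "\<Prod>x\<in>UNIV - {0::'k}. x"
  have "?P = (\<Prod>x\<in>UNIV - {0}. c * x)"
    by (rule prod.reindex_bij_witness[of _ "\<lambda>x. c * x" "\<lambda>x. x / c"]) (use False in auto)
  also have "\<dots> = c ^ (CARD('k) - 1) * ?P"
    by (simp add: prod.distrib card_Diff_singleton)
  finally have "c ^ (CARD('k) - 1) = 1"
    by simp
  then show ?thesis
    using power_minus_mult[of "CARD('k)" c] by simp
qed simp

lemma of_nat_card_eq_0: "of_nat CARD('k) = (0::'k::{ring_1,finite})"
proof -
  have "(\<Sum>x\<in>UNIV. x) = (\<Sum>x\<in>UNIV. x + (1::'k))"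
    by (rule sum.reindex_bij_witness[of _ "\<lambda>x. x + 1" "\<lambda>x. x - 1"]) auto
  then show ?thesis
    by (simp add: sum.distrib)
qed

lemma one_less_card_UNIV: "1 < CARD('k::{zero_neq_one,finite})"
proof -
  have "card {0::'k, 1} \<le> CARD('k)"
    by (rule card_mono) auto
  then show ?thesis by simp
qed

lemma card_coeffs_zero_from:
  "card {p :: 'k::{zero,finite} poly. \<forall>i\<ge>n. coeff p i = 0} = CARD('k) ^ n"
proof -
  let ?L = "{xs :: 'k list. length xs = n}"
  have "{p. \<forall>i\<ge>n. coeff p i = 0} = Poly ` ?L"
  proof (intro equalityI subsetI)
    fix p :: "'k poly" assume "p \<in> {p. \<forall>i\<ge>n. coeff p i = 0}"
    then have "p = Poly (map (coeff p) [0..<n])"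
      by (intro poly_eqI) (auto simp: nth_default_def)
    then show "p \<in> Poly ` ?L"
      by (rule image_eqI) simp
  qed (auto simp: nth_default_def)
  moreover have "inj_on Poly ?L"
  proof (rule inj_onI)
    fix xs ys assume len: "xs \<in> ?L" "ys \<in> ?L" and eq: "Poly xs = Poly ys"
    have "xs ! i = ys ! i" if "i < n" for i
      using len that arg_cong[OF eq, of "\<lambda>p. coeff p i"] by (simp add: nth_default_def)
    then show "xs = ys"
      using len by (simp add: nth_equalityI)
  qed
  ultimately show ?thesis
    using card_lists_length_eq[of "UNIV :: 'k set" n] by (simp add: card_image)
qed

lemma card_residues:
  fixes m :: "'k::{field,finite} poly"
  assumes "m \<noteq> 0"
  shows "card {p. p mod m = p} = CARD('k) ^ degree m"
proof -
  have "p mod m = p \<longleftrightarrow> (\<forall>i\<ge>degree m. coeff p i = 0)" for p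
  proof
    assume "p mod m = p"
    then have "p = 0 \<or> degree p < degree m"
      using degree_mod_less[OF assms, of p] by simp
    then show "\<forall>i\<ge>degree m. coeff p i = 0"
      by (auto intro: coeff_eq_0)
  next
    assume zero: "\<forall>i\<ge>degree m. coeff p i = 0"
    then have "p = 0 \<or> degree p < degree m"
      by (metis leading_coeff_0_iff not_less)
    then show "p mod m = p"
      by (auto simp: mod_poly_less)
  qed
  then show ?thesis
    by (simp add: card_coeffs_zero_from)
qed

locale field_hom =
  fixes f :: "'a::field \<Rightarrow> 'b::field"
  assumes is_field_hom: "is_field_hom f"
begin

sublocale additive f
  by unfold_locales (use is_field_hom in \<open>simp add: is_field_hom_def\<close>)

lemma one [simp]: "f 1 = 1" and mult: "f (x * y) = f x * f y"
  using is_field_hom by (auto simp: is_field_hom_def)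

lemma power: "f (x ^ m) = f x ^ m"
  by (induction m) (simp_all add: mult)

lemma of_nat: "f (of_nat m) = of_nat m"
  by (induction m) (simp_all add: zero add)

lemma eq_0_iff [simp]: "f x = 0 \<longleftrightarrow> x = 0"
  using mult[of x "inverse x"] by (cases "x = 0") (auto simp: zero)

lemma inj: "inj f"
  by (rule injI) (metis diff eq_0_iff right_minus_eq)

end

locale finite_field_hom = field_hom f
  for f :: "'k::{field,finite} \<Rightarrow> 'b::field"
begin

lemma of_nat_card_codomain: "of_nat CARD('k) = (0::'b)"
  using of_nat[of "CARD('k)"] by (simp add: of_nat_card_eq_0 zero)

lemma power_card: "f c ^ CARD('k) = f c"
  by (simp add: finite_field_power_card flip: power)

lemma power_card_power: "f c ^ (CARD('k) ^ i) = f c"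
  by (induction i) (simp_all add: power_mult power_card mult.commute)

lemma prod_diff_range: "(\<Prod>v\<in>range f. z - v) = z ^ CARD('k) - z"
proof -
  let ?q = "CARD('k)"
  let ?P = "[:0, - 1::'b:] + monom 1 ?q"
  have q: "1 < ?q"
    by (rule one_less_card_UNIV)
  have deg: "degree ?P = ?q"
    using q by (subst degree_add_eq_right) (auto simp: degree_monom_eq)
  have "poly ?P z = (\<Prod>v\<in>range f. z - v)"
  proof (rule poly_eq_prod_roots)
    show "lead_coeff ?P = 1"
      using q by (subst lead_coeff_add_le) (auto simp: degree_monom_eq)
    show "degree ?P = card (range f)"
      by (simp add: deg card_image inj)
  qed (auto simp: poly_monom power_card)
  then show ?thesis
    by (simp add: poly_monom)
qed

lemma frobenius_add: "(x + y :: 'b) ^ CARD('k) = x ^ CARD('k) + y ^ CARD('k)"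
proof -
  have "(\<Prod>v\<in>range f. x + y - v) = (\<Prod>v\<in>range f. x - v) + (\<Prod>v\<in>range f. y - v)"
  proof (rule prod_subgroup_diff_add)
    show "0 \<in> range f"
      by (metis zero rangeI)
    show "a - b \<in> range f" if "a \<in> range f" "b \<in> range f" for a b
      using that by (auto simp flip: diff)
  qed simp
  then show ?thesis
    by (simp add: prod_diff_range)
qed

lemma frobenius_power_add:
  "(x + y :: 'b) ^ (CARD('k) ^ i) = x ^ (CARD('k) ^ i) + y ^ (CARD('k) ^ i)"
  by (induction i arbitrary: x y) (simp_all add: power_mult frobenius_add)

end

lemma rsquarefree_if_pderiv_nonzero_at_roots:
  fixes p :: "'a::idom poly"
  assumes "p \<noteq> 0" "\<And>x. poly p x = 0 \<Longrightarrow> poly (pderiv p) x \<noteq> 0"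
  shows "rsquarefree p"
  unfolding rsquarefree_def
proof (intro conjI allI)
  fix x
  have "\<not> 2 \<le> order x p"
  proof
    assume "2 \<le> order x p"
    then have "[:- x, 1:] ^ 2 dvd p"
      by (meson order_1 power_le_dvd)
    then obtain s where p_eq: "p = [:- x, 1:] * ([:- x, 1:] * s)"
      by (metis dvdE mult.assoc power2_eq_square)
    then have "poly (pderiv p) x = 0"
      by (simp only: pderiv_mult poly_add poly_mult) simp
    moreover have "poly p x = 0"
      by (subst p_eq) simp
    ultimately show False
      using assms(2) by blast
  qed
  then show "order x p = 0 \<or> order x p = 1"
    by linarith
qed (fact assms(1))

section \<open>Independent families in modules\<close>

locale comm_ring_module = module scale
  for scale :: "'a::comm_ring_1 \<Rightarrow> 'b::ab_group_add \<Rightarrow> 'b"  (infixr \<open>\<odot>\<close> 75)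
begin

definition indep_family_mod :: "'a \<Rightarrow> 'i set \<Rightarrow> ('i \<Rightarrow> 'b) \<Rightarrow> bool" where
  "indep_family_mod m I x \<longleftrightarrow> (\<forall>a. (\<Sum>i\<in>I. a i \<odot> x i) = 0 \<longrightarrow> (\<forall>i\<in>I. m dvd a i))"

lemma indep_family_modD:
  "indep_family_mod m I x \<Longrightarrow> (\<Sum>i\<in>I. a i \<odot> x i) = 0 \<Longrightarrow> i \<in> I \<Longrightarrow> m dvd a i"
  by (auto simp: indep_family_mod_def)

lemma indep_family_mod_cong:
  "I = J \<Longrightarrow> (\<And>i. i \<in> J \<Longrightarrow> x i = y i) \<Longrightarrow> indep_family_mod m I x \<longleftrightarrow> indep_family_mod m J y"
  by (simp add: indep_family_mod_def)

lemma span_image_eq: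
  assumes "finite I"
  shows "span (x ` I) = range (\<lambda>a. \<Sum>i\<in>I. a i \<odot> x i)"
proof
  let ?R = "range (\<lambda>a. \<Sum>i\<in>I. a i \<odot> x i)"
  have "subspace ?R"
  proof (rule subspaceI)
    show "0 \<in> ?R"
      by (rule range_eqI[of _ _ "\<lambda>_. 0"]) simp
  next
    fix y z assume "y \<in> ?R" "z \<in> ?R"
    then obtain a b where "y = (\<Sum>i\<in>I. a i \<odot> x i)" "z = (\<Sum>i\<in>I. b i \<odot> x i)"
      by blast
    then show "y + z \<in> ?R"
      by (intro range_eqI[of _ _ "\<lambda>i. a i + b i"]) (simp add: scale_left_distrib sum.distrib)
  next
    fix c y assume "y \<in> ?R"
    then obtain a where "y = (\<Sum>i\<in>I. a i \<odot> x i)"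
      by blast
    then show "c \<odot> y \<in> ?R"
      by (intro range_eqI[of _ _ "\<lambda>i. c * a i"]) (simp add: scale_sum_right)
  qed
  moreover have "x ` I \<subseteq> ?R"
  proof
    fix y assume "y \<in> x ` I"
    then obtain i where i: "i \<in> I" "y = x i" by blast
    then have "y = (\<Sum>j\<in>I. (if j = i then 1 else 0) \<odot> x j)"
      using assms by (simp add: if_distrib[of "\<lambda>c. c \<odot> _"] cong: if_cong)
    then show "y \<in> ?R"
      by (rule range_eqI[where x = "\<lambda>j. if j = i then 1 else 0"])
  qed
  ultimately show "span (x ` I) \<subseteq> ?R"
    by (intro span_minimal)
  show "?R \<subseteq> span (x ` I)"
    by (auto intro!: span_sum span_scale intro: span_base)
qed

lemma indep_family_mod_comp:
  assumes indep: "indep_family_mod m J x" and "finite J" "inj_on \<sigma> I" "\<sigma> ` I \<subseteq> J"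
  shows "indep_family_mod m I (\<lambda>i. x (\<sigma> i))"
  unfolding indep_family_mod_def
proof (intro allI impI ballI)
  fix a i assume relation: "(\<Sum>i\<in>I. a i \<odot> x (\<sigma> i)) = 0" and i_in: "i \<in> I"
  define b where "b j = (if j \<in> \<sigma> ` I then a (the_inv_into I \<sigma> j) else 0)" for j
  have b_image: "b (\<sigma> i) = a i" if "i \<in> I" for i
    using that assms(3) by (simp add: b_def the_inv_into_f_f)
  have "(\<Sum>j\<in>J. b j \<odot> x j) = (\<Sum>j\<in>\<sigma> ` I. b j \<odot> x j)"
    using assms(2,4) by (intro sum.mono_neutral_right) (auto simp: b_def)
  also have "\<dots> = (\<Sum>i\<in>I. a i \<odot> x (\<sigma> i))"
    using assms(3) by (simp add: sum.reindex b_image)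
  finally have "(\<Sum>j\<in>J. b j \<odot> x j) = 0"
    using relation by simp
  then have "m dvd b (\<sigma> i)"
    using indep i_in assms(4) by (auto intro: indep_family_modD)
  then show "m dvd a i"
    by (simp add: b_image i_in)
qed

lemma indep_family_mod_subset:
  "indep_family_mod m J x \<Longrightarrow> finite J \<Longrightarrow> I \<subseteq> J \<Longrightarrow> indep_family_mod m I x"
  using indep_family_mod_comp[of m J x "\<lambda>i. i" I] by simp

lemma indep_family_mod_dvd_if_scale_in_span:
  assumes "indep_family_mod m I x" "finite I" "i \<in> I" "c \<odot> x i \<in> span (x ` (I - {i}))"
  shows "m dvd c"
proof -
  obtain a where combination: "c \<odot> x i = (\<Sum>j\<in>I - {i}. a j \<odot> x j)"
    using assms(2,4) by (auto simp: span_image_eq)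
  have "(\<Sum>j\<in>I. ((\<lambda>j. - a j)(i := c)) j \<odot> x j) = c \<odot> x i - (\<Sum>j\<in>I - {i}. a j \<odot> x j)"
    using assms(2,3) by (simp add: sum.remove[of I i] sum_negf)
  then have "m dvd ((\<lambda>j. - a j)(i := c)) i"
    using assms(1,3) combination by (intro indep_family_modD[OF assms(1)]) auto
  then show ?thesis by simp
qed

lemma indep_family_mod_notin_span:
  assumes "indep_family_mod m I x" "finite I" "i \<in> I" "\<not> m dvd 1"
  shows "x i \<notin> span (x ` (I - {i}))"
  using indep_family_mod_dvd_if_scale_in_span[OF assms(1-3), of 1] assms(4) by auto

lemma indep_family_insert_iff:
  assumes "finite I" "i \<notin> I"
  shows "indep_family_mod 0 (insert i I) x \<longleftrightarrow>
    indep_family_mod 0 I x \<and> (\<forall>c. c \<odot> x i \<in> span (x ` I) \<longrightarrow> c = 0)"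
proof (intro iffI conjI allI impI)
  assume indep: "indep_family_mod 0 (insert i I) x"
  then show "indep_family_mod 0 I x"
    by (rule indep_family_mod_subset) (use assms(1) in auto)
  show "c = 0" if "c \<odot> x i \<in> span (x ` I)" for c
    using indep_family_mod_dvd_if_scale_in_span[OF indep, of i c] that assms by simp
next
  assume indep: "indep_family_mod 0 I x \<and> (\<forall>c. c \<odot> x i \<in> span (x ` I) \<longrightarrow> c = 0)"
  show "indep_family_mod 0 (insert i I) x"
    unfolding indep_family_mod_def
  proof (intro allI impI)
    fix a assume "(\<Sum>j\<in>insert i I. a j \<odot> x j) = 0"
    then have relation: "a i \<odot> x i + (\<Sum>j\<in>I. a j \<odot> x j) = 0"
      using assms by simp
    then have "a i \<odot> x i = (\<Sum>j\<in>I. (- a j) \<odot> x j)"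
      by (simp add: sum_negf eq_neg_iff_add_eq_0)
    then have "a i \<odot> x i \<in> span (x ` I)"
      using assms(1) by (simp only: span_image_eq) (rule rangeI)
    with indep have "a i = 0" by blast
    with relation indep show "\<forall>j\<in>insert i I. 0 dvd a j"
      by (auto dest: indep_family_modD)
  qed
qed

end

locale idom_module = comm_ring_module scale
  for scale :: "'a::idom \<Rightarrow> 'b::ab_group_add \<Rightarrow> 'b"  (infixr \<open>\<odot>\<close> 75)
begin

lemma indep_family_exchange:
  assumes indep: "indep_family_mod 0 I x" and fin: "finite I" and k_in: "k \<in> I"
    and scale_z: "c \<odot> z = (\<Sum>i\<in>I. a i \<odot> x i)" and a_k_nonzero: "a k \<noteq> 0"
  shows "indep_family_mod 0 I (x(k := z))"
proof -
  let ?S = "span (x ` (I - {k}))"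
  have "b = 0" if scale_z_in: "b \<odot> z \<in> ?S" for b
  proof -
    have "(\<Sum>i\<in>I - {k}. a i \<odot> x i) \<in> ?S"
      by (intro span_sum span_scale span_base imageI)
    moreover have "c \<odot> b \<odot> z \<in> ?S"
      by (rule span_scale[OF scale_z_in])
    moreover have "(b * a k) \<odot> x k = c \<odot> b \<odot> z - b \<odot> (\<Sum>i\<in>I - {k}. a i \<odot> x i)"
      using scale_z sum.remove[OF fin k_in, of "\<lambda>i. a i \<odot> x i"]
      by (simp add: scale_left_commute[of c b] scale_right_distrib del: scale_scale) simp
    ultimately have "(b * a k) \<odot> x k \<in> ?S"
      by (simp only: span_diff span_scale)
    then have "b * a k = 0"
      using indep_family_mod_dvd_if_scale_in_span[OF indep fin k_in, of "b * a k"] by simp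
    then show ?thesis
      using a_k_nonzero by simp
  qed
  moreover have "indep_family_mod 0 (I - {k}) (x(k := z))"
    using indep_family_mod_subset[OF indep fin, of "I - {k}"]
    by (subst indep_family_mod_cong[OF refl, of _ _ x]) auto
  ultimately have "indep_family_mod 0 (insert k (I - {k})) (x(k := z))"
    using fin by (subst indep_family_insert_iff) auto
  then show ?thesis
    using k_in by (simp add: insert_absorb)
qed

end

section \<open>Drinfeld modules\<close>

locale drinfeld = h: field_hom h
  for h :: "'k::{field,finite} poly fract \<Rightarrow> 'c::field" +
  fixes K :: "'c set" and s :: nat and \<rho> :: "'c poly"
  assumes drinfeld_module: "drinfeld_module h K s \<rho>"
begin

abbreviation act :: "'k poly \<Rightarrow> 'c \<Rightarrow> 'c" where
  "act a x \<equiv> drinfeld_act h \<rho> a x"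

definition const :: "'k \<Rightarrow> 'c" where "const c = h (to_fract [:c:])"

sublocale const: finite_field_hom const
  by unfold_locales
    (simp add: is_field_hom_def const_def one_pCons[symmetric] mult.commute
      flip: h.add h.mult to_fract_add to_fract_mult)

lemma rank_pos: "1 \<le> s"
  using drinfeld_module by (simp add: drinfeld_module_def)

lemma rho_eq: "\<rho> = (\<Sum>i\<le>s. monom (coeff \<rho> (CARD('k) ^ i)) (CARD('k) ^ i))"
  and coeff_rho_1: "coeff \<rho> 1 = t_elem h"
  and coeff_rho_in: "i \<in> {1..s} \<Longrightarrow> coeff \<rho> (CARD('k) ^ i) \<in> K"
proof -
  obtain a where a_in: "\<forall>i\<in>{1..s}. a i \<in> K"
    and rho: "\<rho> = monom (t_elem h) 1 + (\<Sum>i=1..s. monom (a i) (CARD('k) ^ i))"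
    using drinfeld_module by (auto simp: drinfeld_module_def)
  define c where "c = a(0 := t_elem h)"
  have "(\<Sum>i=1..s. monom (a i) (CARD('k) ^ i)) = (\<Sum>i=1..s. monom (c i) (CARD('k) ^ i))"
    by (intro sum.cong) (auto simp: c_def)
  then have rho_c: "\<rho> = (\<Sum>i\<le>s. monom (c i) (CARD('k) ^ i))"
    by (simp add: rho c_def sum.atLeast_Suc_atMost atMost_atLeast0)
  have coeff: "coeff \<rho> (CARD('k) ^ i) = c i" if "i \<le> s" for i
    using that one_less_card_UNIV[where 'k = 'k] by (simp add: rho_c coeff_sum)
  show "\<rho> = (\<Sum>i\<le>s. monom (coeff \<rho> (CARD('k) ^ i)) (CARD('k) ^ i))"
    by (subst rho_c) (simp add: coeff)
  show "coeff \<rho> 1 = t_elem h"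
    using coeff[of 0] by (simp add: c_def)
  show "i \<in> {1..s} \<Longrightarrow> coeff \<rho> (CARD('k) ^ i) \<in> K"
    using a_in by (simp add: coeff c_def)
qed

lemma coeff_rho_eq_0: "(\<And>i. CARD('k) ^ i \<noteq> j) \<Longrightarrow> coeff \<rho> j = 0"
  by (subst rho_eq) (simp add: coeff_sum)

lemma poly_rho: "poly \<rho> x = (\<Sum>i\<le>s. coeff \<rho> (CARD('k) ^ i) * x ^ (CARD('k) ^ i))"
  by (subst rho_eq) (simp add: poly_sum poly_monom)

lemma poly_rho_add: "poly \<rho> (x + y) = poly \<rho> x + poly \<rho> y"
  by (simp add: poly_rho const.frobenius_power_add distrib_left sum.distrib)

lemma poly_rho_0 [simp]: "poly \<rho> 0 = 0"
  by (simp add: poly_rho zero_power)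

lemma poly_rho_const: "poly \<rho> (const c * x) = const c * poly \<rho> x"
  by (simp add: poly_rho power_mult_distrib const.power_card_power sum_distrib_left mult_ac)

lemma degree_rho_le: "degree \<rho> \<le> CARD('k) ^ s"
proof (subst rho_eq, intro degree_sum_le)
  show "degree (monom (coeff \<rho> (CARD('k) ^ i)) (CARD('k) ^ i)) \<le> CARD('k) ^ s" if "i \<in> {..s}" for i
    using that by (intro order.trans[OF degree_monom_le] power_increasing) (auto simp: Suc_le_eq)
qed simp

lemma pderiv_rho: "pderiv \<rho> = [:t_elem h:]"
proof (rule poly_eqI)
  fix n
  show "coeff (pderiv \<rho>) n = coeff [:t_elem h:] n"
  proof (cases "n = 0 \<or> coeff \<rho> (Suc n) = 0")
    case False
    then obtain i where power_eq: "Suc n = CARD('k) ^ i"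
      using coeff_rho_eq_0[of "Suc n"] by metis
    with False have "0 < i" by (cases i) auto
    then have "of_nat (Suc n) = (0::'c)"
      using const.of_nat_card_codomain by (simp add: power_eq del: of_nat_Suc)
    then show ?thesis
      using False by (simp add: coeff_pderiv coeff_pCons split: nat.splits)
  qed (use coeff_rho_1 in \<open>auto simp: coeff_pderiv coeff_pCons split: nat.splits\<close>)
qed

lemma drinfeld_poly_0 [simp]: "drinfeld_poly h \<rho> 0 = 0"
  by (simp add: drinfeld_poly_def h.zero)

lemma drinfeld_poly_pCons:
  "drinfeld_poly h \<rho> (pCons c p) = [:0, const c:] + pcompose (drinfeld_poly h \<rho> p) \<rho>"
proof (cases "p = 0")
  case True
  then show ?thesis
    by (simp add: drinfeld_poly_def const_def h.zero)
next
  case False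
  have iterate: "(pcompose \<rho> ^^ Suc i) [:0, 1:] = pcompose ((pcompose \<rho> ^^ i) [:0, 1:]) \<rho>" for i
    by (induction i) (simp_all add: pcompose_assoc pcompose_pCons)
  have "drinfeld_poly h \<rho> (pCons c p) =
      (\<Sum>i\<le>Suc (degree p). smult (const (coeff (pCons c p) i)) ((pcompose \<rho> ^^ i) [:0, 1:]))"
    using False by (simp add: drinfeld_poly_def const_def)
  also have "\<dots> = smult (const c) [:0, 1:] +
      (\<Sum>i\<le>degree p. smult (const (coeff p i)) ((pcompose \<rho> ^^ Suc i) [:0, 1:]))"
    by (subst sum.atMost_Suc_shift) simp
  also have "(\<Sum>i\<le>degree p. smult (const (coeff p i)) ((pcompose \<rho> ^^ Suc i) [:0, 1:])) =
      pcompose (drinfeld_poly h \<rho> p) \<rho>"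
    by (simp only: iterate drinfeld_poly_def const_def pcompose_sum pcompose_smult)
  finally show ?thesis by simp
qed

lemma pderiv_drinfeld_poly: "pderiv (drinfeld_poly h \<rho> a) = [:h (to_fract a):]"
proof (induction a)
  case (pCons c p)
  have "to_fract (pCons c p) = to_fract [:c:] + to_fract p * to_fract [:0, 1:]"
    by (simp flip: to_fract_add to_fract_mult)
  then show ?case
    by (simp add: drinfeld_poly_pCons pderiv_add pderiv_pcompose pderiv_rho pderiv_pCons pCons.IH
        h.add h.mult const_def)
qed (simp add: h.zero)

lemma drinfeld_poly_nonzero: "a \<noteq> 0 \<Longrightarrow> drinfeld_poly h \<rho> a \<noteq> 0"
  using pderiv_drinfeld_poly[of a] by auto

lemma rsquarefree_drinfeld_poly: "a \<noteq> 0 \<Longrightarrow> rsquarefree (drinfeld_poly h \<rho> a)"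
  by (rule rsquarefree_if_pderiv_nonzero_at_roots)
    (simp_all add: drinfeld_poly_nonzero pderiv_drinfeld_poly)

lemma degree_drinfeld_poly_le: "degree (drinfeld_poly h \<rho> a) \<le> CARD('k) ^ (s * degree a)"
proof (induction a)
  case (pCons c p)
  show ?case
  proof (cases "p = 0")
    case True
    then show ?thesis
      by (simp add: drinfeld_poly_pCons)
  next
    case False
    have "degree [:0, const c:] \<le> CARD('k) ^ (s * degree (pCons c p))"
      by (simp add: Suc_le_eq)
    moreover have "degree (pcompose (drinfeld_poly h \<rho> p) \<rho>) \<le>
        CARD('k) ^ (s * degree p) * CARD('k) ^ s"
      unfolding degree_pcompose by (rule mult_le_mono[OF pCons.IH degree_rho_le])
    ultimately show ?thesis
      using False by (auto simp: drinfeld_poly_pCons power_add mult.commute intro!: degree_add_le)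
  qed
qed simp

lemma coeff_drinfeld_poly_in:
  assumes zero: "0 \<in> S" and add: "\<And>x y. x \<in> S \<Longrightarrow> y \<in> S \<Longrightarrow> x + y \<in> S"
    and mult: "\<And>x y. x \<in> S \<Longrightarrow> y \<in> S \<Longrightarrow> x * y \<in> S"
    and range_h: "range h \<subseteq> S" and K_subset: "K \<subseteq> S"
  shows "coeff (drinfeld_poly h \<rho> a) i \<in> S"
proof (induction a arbitrary: i)
  case (pCons c p)
  have "coeff \<rho> (CARD('k) ^ j) \<in> S" if "j \<le> s" for j
    using that coeff_rho_1 coeff_rho_in[of j] range_h K_subset by (cases "j = 0") auto
  moreover have sum_in: "(\<Sum>j\<in>J. f j) \<in> S" if "\<And>j. j \<in> J \<Longrightarrow> f j \<in> S" for J :: "nat set" and f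
    using that by (induction J rule: infinite_finite_induct) (auto simp: zero add)
  ultimately have "coeff \<rho> j \<in> S" for j
    by (subst rho_eq) (auto simp: coeff_sum zero intro!: sum_in)
  then have "coeff (pcompose (drinfeld_poly h \<rho> p) \<rho>) j \<in> S" for j
    by (intro coeff_pcompose_semiring_closed zero add mult pCons.IH)
  moreover have "coeff [:0, const c:] j \<in> S" for j
    using zero range_h by (auto simp: coeff_pCons const_def split: nat.splits)
  ultimately show ?case
    by (simp add: drinfeld_poly_pCons add)
qed (simp add: zero)

lemma act_pCons: "act (pCons c p) x = const c * x + act p (poly \<rho> x)"
  by (simp add: drinfeld_poly_pCons poly_pcompose mult.commute)

lemma act_add_right: "act a (x + y) = act a x + act a y"
  by (induction a arbitrary: x y) (simp_all add: act_pCons poly_rho_add algebra_simps)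

lemma act_add_left: "act (a + b) x = act a x + act b x"
  by (induction a b arbitrary: x rule: poly_induct2)
    (simp_all add: act_pCons const.add algebra_simps)

lemma act_smult: "act (smult c a) x = const c * act a x"
  by (induction a arbitrary: x) (simp_all add: act_pCons const.mult algebra_simps)

lemma act_poly_rho: "act a (poly \<rho> x) = poly \<rho> (act a x)"
  by (induction a arbitrary: x) (simp_all add: act_pCons poly_rho_add poly_rho_const)

lemma act_mult: "act (a * b) x = act a (act b x)"
  by (induction a arbitrary: x)
    (simp_all add: act_pCons act_add_left act_smult act_poly_rho const.zero)

sublocale idom_module act
  by unfold_locales
    (simp_all add: act_add_right act_add_left act_mult one_pCons act_pCons)

lemma lin_indep_mod_iff: "lin_indep_mod h \<rho> m I x \<longleftrightarrow> indep_family_mod m I x"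
  by (simp add: lin_indep_mod_def indep_family_mod_def)

lemma subspace_A_lattice: "A_lattice h w \<rho> d \<Lambda> \<Longrightarrow> subspace \<Lambda>"
  unfolding A_lattice_def
proof (elim conjE exE)
  fix b assume "\<Lambda> = {x. \<exists>a. x = (\<Sum>i=1..d. act (a i) (b i))}"
  then have "\<Lambda> = span (b ` {1..d})"
    by (auto simp: span_image_eq)
  then show "subspace \<Lambda>" by simp
qed

text \<open>There are at most \<open>q\<^bsup>s deg m\<^esup>\<close> roots of \<open>\<rho>\<^sub>m\<close>, and as many combinations of the family with
  coefficients reduced modulo \<open>m\<close>.\<close>

lemma torsion_subset_span:
  assumes m_nonzero: "m \<noteq> 0" and indep: "indep_family_mod m {1..s} x"
    and torsion: "\<And>i. i \<in> {1..s} \<Longrightarrow> act m (x i) = 0"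
  shows "{y. act m y = 0} \<subseteq> span (x ` {1..s})"
proof -
  let ?D = "{1..s} \<rightarrow>\<^sub>E {p. p mod m = p}"
  let ?f = "\<lambda>c. \<Sum>i=1..s. act (c i) (x i)"
  have "inj_on ?f ?D"
  proof (rule inj_onI)
    fix c c' assume c_in: "c \<in> ?D" "c' \<in> ?D" and eq: "?f c = ?f c'"
    then have "(\<Sum>i=1..s. act (c i - c' i) (x i)) = 0"
      by (simp only: scale_left_diff_distrib sum_subtractf right_minus_eq)
    then have "m dvd c i - c' i" if "i \<in> {1..s}" for i
      using indep_family_modD[OF indep, of "\<lambda>i. c i - c' i"] that by blast
    then have "c i mod m = c' i mod m" if "i \<in> {1..s}" for i
      using that by (simp add: mod_eq_dvd_iff)
    then have "c i = c' i" if "i \<in> {1..s}" for i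
      using that PiE_mem[OF c_in(1) that] PiE_mem[OF c_in(2) that] by simp
    then show "c = c'"
      by (rule PiE_ext[OF c_in])
  qed
  then have "card (?f ` ?D) = CARD('k) ^ (s * degree m)"
    by (simp add: card_image card_PiE card_residues[OF m_nonzero] mult.commute flip: power_mult)
  moreover have "card {y. act m y = 0} \<le> CARD('k) ^ (s * degree m)"
    using card_poly_roots_bound[OF drinfeld_poly_nonzero[OF m_nonzero]] degree_drinfeld_poly_le
    by (rule order.trans)
  moreover have "?f ` ?D \<subseteq> {y. act m y = 0}"
    using torsion by (auto simp: scale_sum_right scale_left_commute[of m] simp del: scale_scale)
  moreover have "finite {y. act m y = 0}"
    by (rule poly_roots_finite[OF drinfeld_poly_nonzero[OF m_nonzero]])
  ultimately have "?f ` ?D = {y. act m y = 0}"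
    by (intro card_seteq) simp_all
  then have "{y. act m y = 0} \<subseteq> range ?f"
    by blast
  then show ?thesis
    by (simp only: span_image_eq finite_atLeastAtMost)
qed

end

section \<open>Valuations\<close>

lemma all_pos_iff_all_powr: "(\<forall>\<epsilon>>0. P \<epsilon>) \<longleftrightarrow> (\<forall>R::real. P (2 powr (- R)))"
proof (intro iffI allI impI)
  fix \<epsilon> :: real assume "\<forall>R. P (2 powr (- R))" and "0 < \<epsilon>"
  then show "P \<epsilon>"
    using spec[of "\<lambda>R. P (2 powr (- R))" "- log 2 \<epsilon>"] by simp
qed simp

locale valued =
  fixes w :: "'c::field \<Rightarrow> ereal"
  assumes is_valuation: "is_valuation w"
begin

lemma w_mult: "w (x * y) = w x + w y" and w_add_ge: "min (w x) (w y) \<le> w (x + y)"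
  and w_eq_inf_iff: "w x = \<infinity> \<longleftrightarrow> x = 0" and w_neq_MInf: "w x \<noteq> - \<infinity>"
  using is_valuation by (auto simp: is_valuation_def)

lemma w_0 [simp]: "w 0 = \<infinity>"
  by (simp add: w_eq_inf_iff)

lemma ex_real_w: "x \<noteq> 0 \<Longrightarrow> \<exists>v. w x = ereal v"
  using w_neq_MInf[of x] w_eq_inf_iff[of x] by (cases "w x") auto

lemma ex_real_w_neg: "w x < 0 \<Longrightarrow> \<exists>v<0. w x = ereal v"
  using ex_real_w[of x] by (cases "x = 0") auto

lemma w_1 [simp]: "w 1 = 0"
  using w_mult[of 1 1] ex_real_w[of 1] by auto

lemma w_minus [simp]: "w (- x) = w x"
proof -
  have "w (-1) = 0"
    using w_mult[of "-1" "-1"] ex_real_w[of "-1"] by auto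
  then show ?thesis using w_mult[of "-1" x] by simp
qed

lemma w_diff_commute: "w (x - y) = w (y - x)"
  by (metis minus_diff_eq w_minus)

lemma w_add_geI: "c \<le> w x \<Longrightarrow> c \<le> w y \<Longrightarrow> c \<le> w (x + y)"
  by (meson min.boundedI order.trans w_add_ge)

lemma w_diff_geI: "c \<le> w x \<Longrightarrow> c \<le> w y \<Longrightarrow> c \<le> w (x - y)"
  using w_add_geI[of c x "- y"] by simp

lemma w_add_gtI: "c < w x \<Longrightarrow> c < w y \<Longrightarrow> c < w (x + y)"
  by (metis less_le_trans min_less_iff_conj w_add_ge)

lemma w_diff_gtI: "c < w x \<Longrightarrow> c < w y \<Longrightarrow> c < w (x - y)"
  using w_add_gtI[of c x "- y"] by simp

lemma w_add_eq:
  assumes "w x < w y"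
  shows "w (x + y) = w x"
proof (rule antisym)
  show "w x \<le> w (x + y)"
    using assms by (intro w_add_geI) auto
  show "w (x + y) \<le> w x"
    by (intro leI notI) (use w_diff_gtI[of "w x" "x + y" y] assms in simp)
qed

lemma w_diff_eq: "w x < w y \<Longrightarrow> w (x - y) = w x"
  using w_add_eq[of x "- y"] by simp

lemma w_sum_gt:
  assumes "\<And>i. i \<in> I \<Longrightarrow> c < w (f i)" "c < \<infinity>"
  shows "c < w (\<Sum>i\<in>I. f i)"
  using assms by (induction I rule: infinite_finite_induct) (auto intro: w_add_gtI)

lemma w_sum_eq_dominant:
  assumes "finite I" "k \<in> I" "f k \<noteq> 0" "\<And>i. i \<in> I - {k} \<Longrightarrow> w (f k) < w (f i)"
  shows "w (\<Sum>i\<in>I. f i) = w (f k)"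
proof -
  have "w (f k) < w (\<Sum>i\<in>I - {k}. f i)"
    using assms(3,4) by (intro w_sum_gt) (auto simp: less_top[symmetric] top_ereal_def w_eq_inf_iff)
  then show ?thesis
    by (simp add: sum.remove[OF assms(1,2)] w_add_eq)
qed

lemma w_sum_ge: "(\<And>i. i \<in> I \<Longrightarrow> c \<le> w (f i)) \<Longrightarrow> c \<le> w (\<Sum>i\<in>I. f i)"
  by (induction I rule: infinite_finite_induct) (auto intro: w_add_geI)

lemma w_prod: "w (\<Prod>i\<in>I. f i) = (\<Sum>i\<in>I. w (f i))"
  by (induction I rule: infinite_finite_induct) (auto simp: w_mult)

lemma w_power: "w x = ereal v \<Longrightarrow> w (x ^ m) = ereal (real m * v)"
  by (induction m) (auto simp: w_mult algebra_simps zero_ereal_def)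

lemma w_power_nonneg: "0 \<le> w x \<Longrightarrow> 0 \<le> w (x ^ m)"
  by (induction m) (auto simp: w_mult)

lemma w_eq_0_if_power_eq:
  assumes "x ^ m = x" "1 < m" "x \<noteq> 0"
  shows "w x = 0"
proof -
  obtain v where w_x: "w x = ereal v" using ex_real_w assms by blast
  then have "real m * v = v"
    using w_power[OF w_x, of m] assms(1) by simp
  then show ?thesis using w_x assms(2) by auto
qed

lemma w_divide:
  assumes "y \<noteq> 0"
  shows "w (x / y) = w x - w y"
proof -
  obtain v where w_y: "w y = ereal v" using ex_real_w assms by blast
  have "w x = w (x / y) + w y"
    using assms by (simp flip: w_mult)
  then show ?thesis
    by (cases "w (x / y)") (auto simp: w_y)
qed

interpretation M: Metric_space UNIV "val_dist w"
  by (rule Metric_space_val_dist[OF is_valuation])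

lemma val_dist_less_iff: "val_dist w x y < 2 powr (- R) \<longleftrightarrow> ereal R < w (x - y)"
proof (cases "x = y")
  case False
  then obtain v where "w (x - y) = ereal v" using ex_real_w[of "x - y"] by auto
  then show ?thesis using False by (auto simp: val_dist_def)
qed (simp add: val_dist_def)

lemma limitin_val_iff:
  "limitin (val_top w) f l F \<longleftrightarrow> (\<forall>R::real. \<forall>\<^sub>F x in F. ereal R < w (f x - l))"
  unfolding M.limitin_metric
  by (subst all_pos_iff_all_powr) (auto simp: val_dist_less_iff elim: eventually_mono)

lemma closure_val_iff:
  "x \<in> val_top w closure_of S \<longleftrightarrow> (\<forall>R::real. \<exists>y\<in>S. ereal R < w (x - y))"
  unfolding M.metric_closure_of mem_Collect_eq M.in_mball
  by (subst all_pos_iff_all_powr) (auto simp: val_dist_less_iff intro: less_le_trans)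

lemma limitin_val_unique:
  "limitin (val_top w) f a F \<Longrightarrow> limitin (val_top w) f b F \<Longrightarrow> F \<noteq> bot \<Longrightarrow> a = b"
  by (rule M.limitin_metric_unique)

lemma limitin_val_add:
  assumes "limitin (val_top w) f a F" "limitin (val_top w) g b F"
  shows "limitin (val_top w) (\<lambda>x. f x + g x) (a + b) F"
  unfolding limitin_val_iff
proof
  fix R :: real
  have "\<forall>\<^sub>F x in F. ereal R < w (f x - a)" "\<forall>\<^sub>F x in F. ereal R < w (g x - b)"
    using assms by (simp_all add: limitin_val_iff)
  then show "\<forall>\<^sub>F x in F. ereal R < w (f x + g x - (a + b))"
  proof eventually_elim
    case (elim x)
    then show ?case
      using w_add_gtI[of "ereal R" "f x - a" "g x - b"] by (simp add: algebra_simps)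
  qed
qed

lemma eventually_w_eq_limit:
  assumes "limitin (val_top w) f a F" "a \<noteq> 0"
  shows "\<forall>\<^sub>F x in F. w (f x) = w a"
proof -
  obtain v where w_a: "w a = ereal v"
    using ex_real_w[OF assms(2)] by blast
  have "\<forall>\<^sub>F x in F. ereal v < w (f x - a)"
    using assms(1) by (simp add: limitin_val_iff)
  then show ?thesis
  proof eventually_elim
    case (elim x)
    then show ?case
      using w_add_eq[of a "f x - a"] w_a by simp
  qed
qed

lemma w_limit_le:
  assumes f_limit: "limitin (val_top w) f a F" and g_limit: "limitin (val_top w) g b F"
    and eventually_le: "\<forall>\<^sub>F x in F. w (f x) \<le> w (g x)" and F_nontrivial: "F \<noteq> bot"
  shows "w a \<le> w b"
proof (cases "b = 0")
  case False
  then obtain v where v: "w b = ereal v"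
    using ex_real_w by blast
  have "\<forall>\<^sub>F x in F. w (g x) = w b" "\<forall>\<^sub>F x in F. ereal v < w (f x - a)"
    using eventually_w_eq_limit[OF g_limit False] f_limit by (simp_all add: limitin_val_iff)
  with eventually_le have "\<forall>\<^sub>F x in F. w a \<le> w b"
  proof eventually_elim
    case (elim x)
    show ?case
    proof (rule ccontr)
      assume "\<not> w a \<le> w b"
      then have "w b < w (f x)"
        using w_add_gtI[of "w b" "f x - a" a] elim(3) v by simp
      then show False
        using elim(1,2) by simp
    qed
  qed
  then show ?thesis
    using F_nontrivial by simp
qed simp

lemma subset_closure_val: "S \<subseteq> val_top w closure_of S"
  by (rule closure_of_subset) simp

lemma closure_val_add:
  assumes add: "\<And>x y. x \<in> S \<Longrightarrow> y \<in> S \<Longrightarrow> x + y \<in> S"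
    and "x \<in> val_top w closure_of S" "y \<in> val_top w closure_of S"
  shows "x + y \<in> val_top w closure_of S"
  unfolding closure_val_iff
proof
  fix R :: real
  obtain x' y' where "x' \<in> S" "ereal R < w (x - x')" "y' \<in> S" "ereal R < w (y - y')"
    using assms(2,3) unfolding closure_val_iff by metis
  moreover have "x + y - (x' + y') = (x - x') + (y - y')" by simp
  ultimately show "\<exists>z\<in>S. ereal R < w (x + y - z)"
    using add w_add_gtI by metis
qed

lemma closure_val_mult:
  assumes mult: "\<And>x y. x \<in> S \<Longrightarrow> y \<in> S \<Longrightarrow> x * y \<in> S"
    and x_closure: "x \<in> val_top w closure_of S" and y_closure: "y \<in> val_top w closure_of S"
  shows "x * y \<in> val_top w closure_of S"
  unfolding closure_val_iff
proof
  fix R :: real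
  have close: "\<exists>s\<in>S. ereal R < w ((z - s) * t)" if "z \<in> val_top w closure_of S" for z t
  proof (cases "t = 0")
    case False
    then obtain b where w_t: "w t = ereal b" using ex_real_w by blast
    have "\<exists>s\<in>S. ereal (R - b) < w (z - s)"
      using that by (simp only: closure_val_iff)
    then obtain s where "s \<in> S" "ereal (R - b) < w (z - s)"
      by blast
    then show ?thesis
      by (intro bexI[of _ s]) (cases "w (z - s)"; simp add: w_mult w_t)+
  qed (use that in \<open>auto simp: closure_val_iff\<close>)
  obtain x' where x'_close: "x' \<in> S" "ereal R < w ((x - x') * y)"
    using close[OF x_closure] by blast
  obtain y' where y'_close: "y' \<in> S" "ereal R < w ((y - y') * x')"
    using close[OF y_closure] by blast
  have "x * y - x' * y' = (x - x') * y + (y - y') * x'"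
    by (simp add: algebra_simps)
  then have "ereal R < w (x * y - x' * y')"
    using w_add_gtI[OF x'_close(2) y'_close(2)] by simp
  then show "\<exists>z\<in>S. ereal R < w (x * y - z)"
    using x'_close(1) y'_close(1) mult by blast
qed

end

section \<open>The exponential of a discrete subgroup\<close>

locale discrete_subgroup = valued w
  for w :: "'c::field \<Rightarrow> ereal" +
  fixes \<Lambda> :: "'c set"
  assumes zero_in: "0 \<in> \<Lambda>" and diff_in: "\<And>\<mu> \<nu>. \<mu> \<in> \<Lambda> \<Longrightarrow> \<nu> \<in> \<Lambda> \<Longrightarrow> \<mu> - \<nu> \<in> \<Lambda>"
    and finite_ball: "\<And>R::real. finite {\<mu> \<in> \<Lambda>. ereal R \<le> w \<mu>}"
begin

lemma add_in: "\<mu> \<in> \<Lambda> \<Longrightarrow> \<nu> \<in> \<Lambda> \<Longrightarrow> \<mu> + \<nu> \<in> \<Lambda>"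
  using diff_in[of \<mu> "0 - \<nu>"] diff_in[OF zero_in] by simp

abbreviation subgroup_ball :: "real \<Rightarrow> 'c set" where
  "subgroup_ball R \<equiv> {\<mu> \<in> \<Lambda>. ereal R \<le> w \<mu>}"

definition coset_maximal :: "'c \<Rightarrow> bool" where
  "coset_maximal z \<longleftrightarrow> (\<forall>\<mu>\<in>\<Lambda>. w (z - \<mu>) \<le> w z)"

lemma ex_coset_maximal: "\<exists>l\<in>\<Lambda>. coset_maximal (z - l)"
proof (cases "z = 0")
  case True
  then show ?thesis
    by (intro bexI[of _ 0]) (simp_all add: coset_maximal_def zero_in)
next
  case False
  then obtain v where w_z: "w z = ereal v" using ex_real_w by blast
  let ?S = "subgroup_ball v"
  let ?W = "(\<lambda>\<mu>. w (z - \<mu>)) ` ?S"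
  have zero_in_ball: "0 \<in> ?S" using zero_in by simp
  have "Max ?W \<in> ?W" using finite_ball zero_in_ball by (intro Max_in) auto
  then obtain l where l_max: "l \<in> ?S" "w (z - l) = Max ?W" by auto
  have ball_max: "w (z - \<mu>) \<le> w (z - l)" if "\<mu> \<in> ?S" for \<mu>
    using that finite_ball l_max(2) by (auto intro!: Max_ge)
  have "w (z - \<mu>) \<le> w (z - l)" if "\<mu> \<in> \<Lambda>" for \<mu>
  proof (cases "\<mu> \<in> ?S")
    case False
    then have less: "w \<mu> < w z" using that w_z by auto
    have "w (z - \<mu>) = w \<mu>"
      using w_diff_eq[OF less] w_diff_commute[of z \<mu>] by simp
    also have "\<dots> \<le> w (z - 0)" using less by simp
    also have "\<dots> \<le> w (z - l)" by (rule ball_max[OF zero_in_ball])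
    finally show ?thesis .
  qed (rule ball_max)
  then have "coset_maximal (z - l)"
    using l_max(1) add_in by (auto simp: coset_maximal_def diff_diff_eq)
  then show ?thesis using l_max(1) by blast
qed

definition partial_exp :: "'c set \<Rightarrow> 'c \<Rightarrow> 'c" where
  "partial_exp S z = z * (\<Prod>\<mu>\<in>S. 1 - z / \<mu>)"

text \<open>If \<open>x\<close> is maximal in its coset, then \<open>w (x - \<mu>)\<close> is the minimum of \<open>w x\<close> and \<open>w \<mu>\<close>, so the
  comparison holds factor by factor.\<close>

lemma w_partial_exp_mono:
  assumes x_maximal: "coset_maximal x" and w_le: "w x \<le> w y" and S_subset: "S \<subseteq> \<Lambda> - {0}"
  shows "w (partial_exp S x) \<le> w (partial_exp S y)"
proof -
  have "w (1 - x / \<mu>) \<le> w (1 - y / \<mu>)" if "\<mu> \<in> S" for \<mu>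
  proof -
    have \<mu>_in: "\<mu> \<in> \<Lambda>" "\<mu> \<noteq> 0" using S_subset that by auto
    have factor: "w (1 - z / \<mu>) = w (z - \<mu>) - w \<mu>" for z
    proof -
      have "1 - z / \<mu> = (\<mu> - z) / \<mu>" using \<mu>_in(2) by (simp add: field_simps)
      then show ?thesis using w_divide[OF \<mu>_in(2)] w_diff_commute by simp
    qed
    have w_diff_le: "w (x - \<mu>) \<le> w x"
      using x_maximal \<mu>_in(1) by (simp add: coset_maximal_def)
    have "w (x - \<mu>) \<le> w \<mu>"
    proof (rule ccontr)
      assume less: "\<not> w (x - \<mu>) \<le> w \<mu>"
      then have "w (x - \<mu>) = w \<mu>"
        using w_diff_le w_diff_eq[of \<mu> x] w_diff_commute[of x \<mu>] by simp
      with less show False by simp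
    qed
    then have "w (x - \<mu>) \<le> w (y - \<mu>)"
      using w_diff_le w_le by (intro w_diff_geI) auto
    then show ?thesis unfolding factor by (intro ereal_minus_mono) auto
  qed
  then show ?thesis
    unfolding partial_exp_def w_mult w_prod using w_le by (intro add_mono sum_mono) auto
qed

lemma partial_exp_subgroup_add:
  assumes fin: "finite V" and zero: "0 \<in> V" and diff: "\<And>a b. a \<in> V \<Longrightarrow> b \<in> V \<Longrightarrow> a - b \<in> V"
  shows "partial_exp (V - {0}) (x + y) = partial_exp (V - {0}) x + partial_exp (V - {0}) y"
proof -
  let ?C = "\<Prod>\<mu>\<in>V - {0}. - \<mu>"
  have C_nonzero: "?C \<noteq> 0"
    using fin by simp
  have "partial_exp (V - {0}) z = (\<Prod>\<mu>\<in>V. z - \<mu>) / ?C" for z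
  proof -
    have "(\<Prod>\<mu>\<in>V. z - \<mu>) = z * (\<Prod>\<mu>\<in>V - {0}. z - \<mu>)"
      using prod.remove[OF fin zero, of "\<lambda>\<mu>. z - \<mu>"] by simp
    also have "(\<Prod>\<mu>\<in>V - {0}. z - \<mu>) = (\<Prod>\<mu>\<in>V - {0}. - \<mu> * (1 - z / \<mu>))"
      by (intro prod.cong) (auto simp: field_simps)
    also have "\<dots> = ?C * (\<Prod>\<mu>\<in>V - {0}. 1 - z / \<mu>)"
      by (rule prod.distrib)
    finally show ?thesis
      using C_nonzero by (simp add: partial_exp_def)
  qed
  then show ?thesis
    by (simp add: prod_subgroup_diff_add[OF assms] add_divide_distrib)
qed

lemma filterlim_balls:
  "filterlim (\<lambda>n. subgroup_ball (- real n) - {0}) (finite_subsets_at_top (\<Lambda> - {0})) sequentially"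
  unfolding filterlim_finite_subsets_at_top
proof (intro allI impI, elim conjE)
  fix X assume X_subset: "finite X" "X \<subseteq> \<Lambda> - {0}"
  have "\<forall>\<^sub>F n in sequentially. ereal (- real n) \<le> w \<mu>" if "\<mu> \<in> X" for \<mu>
  proof -
    obtain v where w_\<mu>: "w \<mu> = ereal v"
      using ex_real_w X_subset(2) \<open>\<mu> \<in> X\<close> by blast
    have "\<forall>\<^sub>F n in sequentially. - v \<le> real n"
      by real_asymp
    then show ?thesis
      by eventually_elim (simp add: w_\<mu>)
  qed
  then have "\<forall>\<^sub>F n in sequentially. \<forall>\<mu>\<in>X. ereal (- real n) \<le> w \<mu>"
    by (simp add: eventually_ball_finite X_subset(1))
  then show "\<forall>\<^sub>F n in sequentially. finite (subgroup_ball (- real n) - {0}) \<and>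
      X \<subseteq> subgroup_ball (- real n) - {0} \<and> subgroup_ball (- real n) - {0} \<subseteq> \<Lambda> - {0}"
    by eventually_elim (use X_subset(2) finite_ball in auto)
qed

end

locale lattice_exponential = discrete_subgroup w \<Lambda>
  for w :: "'c::field \<Rightarrow> ereal" and \<Lambda> +
  fixes e :: "'c \<Rightarrow> 'c"
  assumes limitin_partial_exp:
    "\<And>z. limitin (val_top w) (\<lambda>S. partial_exp S z) (e z) (finite_subsets_at_top (\<Lambda> - {0}))"
begin

sublocale additive e
proof
  fix x y
  let ?E = "\<lambda>z n. partial_exp (subgroup_ball (- real n) - {0}) z"
  have lim: "limitin (val_top w) (?E z) (e z) sequentially" for z
    using limitin_partial_exp[of z] unfolding limitin_val_iff
    by (intro allI eventually_compose_filterlim[OF _ filterlim_balls]) auto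
  have "?E (x + y) n = ?E x n + ?E y n" for n
    by (rule partial_exp_subgroup_add) (auto simp: zero_in diff_in w_diff_geI finite_ball)
  then have "limitin (val_top w) (?E (x + y)) (e x + e y) sequentially"
    using limitin_val_add[OF lim lim] by simp
  then show "e (x + y) = e x + e y"
    using limitin_val_unique[OF lim] by simp
qed

lemma w_exp_mono:
  assumes "coset_maximal x" "w x \<le> w y"
  shows "w (e x) \<le> w (e y)"
proof (rule w_limit_le[OF limitin_partial_exp limitin_partial_exp])
  show "\<forall>\<^sub>F S in finite_subsets_at_top (\<Lambda> - {0}). w (partial_exp S x) \<le> w (partial_exp S y)"
    using w_partial_exp_mono[OF assms]
    by (intro eventually_finite_subsets_at_top_weakI) auto
qed simp

end

section \<open>Good reduction\<close>

locale good_drinfeld = drinfeld h K s \<rho> + valued w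
  for h :: "'k::{field,finite} poly fract \<Rightarrow> 'c::field" and w K s \<rho> +
  assumes good: "good_reduction CARD('k) w s \<rho>" and w_t_nonneg: "0 \<le> w (t_elem h)"
begin

lemma w_const: "c \<noteq> 0 \<Longrightarrow> w (const c) = 0"
  using w_eq_0_if_power_eq[OF const.power_card one_less_card_UNIV] by simp

lemma w_const_nonneg: "0 \<le> w (const c)"
  using w_const[of c] by (cases "c = 0") (auto simp: const.zero)

lemma w_coeff_rho_nonneg: "i \<le> s \<Longrightarrow> 0 \<le> w (coeff \<rho> (CARD('k) ^ i))"
  using good w_t_nonneg coeff_rho_1
  by (cases "i = 0") (auto simp: good_reduction_def stable_reduction_def)

lemma w_coeff_rho_rank: "w (coeff \<rho> (CARD('k) ^ s)) = 0"
  using good by (simp add: good_reduction_def stable_reduction_def)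

lemma w_rho_nonneg: "0 \<le> w x \<Longrightarrow> 0 \<le> w (poly \<rho> x)"
  unfolding poly_rho by (intro w_sum_ge) (simp add: w_mult w_coeff_rho_nonneg w_power_nonneg)

lemma w_act_nonneg: "0 \<le> w x \<Longrightarrow> 0 \<le> w (act a x)"
proof (induction a arbitrary: x)
  case (pCons c p)
  have "0 \<le> w (const c * x)"
    using pCons.prems by (simp add: w_mult w_const_nonneg)
  moreover have "0 \<le> w (act p (poly \<rho> x))"
    by (intro pCons.IH w_rho_nonneg pCons.prems)
  ultimately show ?case
    unfolding act_pCons by (rule w_add_geI)
qed simp

lemma w_rho_neg:
  assumes w_x: "w x = ereal v" "v < 0"
  shows "w (poly \<rho> x) = ereal (real CARD('k) ^ s * v)"
proof -
  let ?q = "real CARD('k)"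
  let ?f = "\<lambda>i. coeff \<rho> (CARD('k) ^ i) * x ^ (CARD('k) ^ i)"
  have w_f: "w (?f i) = w (coeff \<rho> (CARD('k) ^ i)) + ereal (?q ^ i * v)" for i
    using w_power[OF w_x(1), of "CARD('k) ^ i"] by (simp add: w_mult)
  have w_top: "w (?f s) = ereal (?q ^ s * v)"
    by (simp add: w_f w_coeff_rho_rank)
  have "w (?f s) < w (?f i)" if "i \<in> {..s} - {s}" for i
  proof -
    have "?q ^ s * v < ?q ^ i * v"
      using that w_x(2) one_less_card_UNIV[where 'k = 'k] by simp
    then have "ereal (?q ^ s * v) < w (?f i)"
      using w_coeff_rho_nonneg[of i] that
      unfolding w_f by (cases "w (coeff \<rho> (CARD('k) ^ i))") auto
    then show ?thesis by (simp only: w_top)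
  qed
  moreover have "?f s \<noteq> 0"
    using w_top by (metis PInfty_neq_ereal(1) w_0)
  ultimately have "w (\<Sum>i\<le>s. ?f i) = w (?f s)"
    by (intro w_sum_eq_dominant) auto
  then show ?thesis
    by (simp only: poly_rho w_top)
qed

lemma w_act_neg:
  assumes "w x = ereal v" "v < 0" "a \<noteq> 0"
  shows "w (act a x) = ereal (real CARD('k) ^ (s * degree a) * v)"
  using assms
proof (induction a arbitrary: x v)
  case (pCons c p)
  let ?q = "real CARD('k)"
  have q_gt_1: "1 < ?q" using one_less_card_UNIV[where 'k = 'k] by simp
  show ?case
  proof (cases "p = 0")
    case True
    then have "c \<noteq> 0" using pCons.prems by simp
    then show ?thesis
      using True pCons.prems by (simp add: act_pCons w_mult w_const)
  next
    case False
    have "?q ^ s * v < 0"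
      using q_gt_1 pCons.prems(2) by (simp add: mult_pos_neg)
    then have "w (act p (poly \<rho> x)) = ereal (?q ^ (s * degree p) * (?q ^ s * v))"
      using pCons.IH[OF w_rho_neg] pCons.prems False by blast
    also have "\<dots> = ereal (?q ^ (s * degree (pCons c p)) * v)"
      using False by (simp add: power_add mult_ac)
    finally have w_p: "w (act p (poly \<rho> x)) = ereal (?q ^ (s * degree (pCons c p)) * v)" .
    have "1 < ?q ^ (s * degree (pCons c p))"
      using q_gt_1 False rank_pos by (intro one_less_power) auto
    then have "?q ^ (s * degree (pCons c p)) * v < v"
      using pCons.prems(2) by simp
    then have "w (act p (poly \<rho> x)) < w (const c * x)"
      unfolding w_p w_mult pCons.prems(1) using w_const_nonneg[of c] by (cases "w (const c)") auto
    from w_add_eq[OF this] show ?thesis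
      unfolding act_pCons w_p by (simp only: add.commute)
  qed
qed simp

lemma w_act_neg_iff:
  assumes "a \<noteq> 0"
  shows "w (act a x) < 0 \<longleftrightarrow> w x < 0"
proof
  assume "w x < 0"
  then obtain v where w_x: "v < 0" "w x = ereal v" using ex_real_w_neg by blast
  then show "w (act a x) < 0"
    using w_act_neg[OF w_x(2,1) assms] by (simp add: mult_pos_neg)
next
  assume "w (act a x) < 0"
  then show "w x < 0" using w_act_nonneg[of x a] by force
qed

lemma w_act_strict_mono:
  assumes a_nonzero: "a \<noteq> 0" and x_neg: "w x < 0" and less: "w x < w y"
  shows "w (act a x) < w (act a y)"
proof (cases "w y < 0")
  case True
  obtain u where w_x: "u < 0" "w x = ereal u" using ex_real_w_neg[OF x_neg] by blast
  obtain v where w_y: "v < 0" "w y = ereal v" using ex_real_w_neg[OF True] by blast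
  show ?thesis
    using w_act_neg[OF w_x(2,1) a_nonzero] w_act_neg[OF w_y(2,1) a_nonzero] less w_x w_y by simp
next
  case False
  then have "0 \<le> w (act a y)"
    by (intro w_act_nonneg) simp
  moreover have "w (act a x) < 0"
    using x_neg a_nonzero by (simp add: w_act_neg_iff)
  ultimately show ?thesis
    by (rule order.strict_trans2[rotated])
qed

lemma w_act_less_if_degree_less:
  assumes b_nonzero: "b \<noteq> 0" and degree: "degree b < degree a"
    and y_neg: "w y < 0" and w_le: "w x \<le> w y"
  shows "w (act a x) < w (act b y)"
proof -
  let ?Q = "\<lambda>n. real CARD('k) ^ (s * n)"
  obtain u where w_x: "u < 0" "w x = ereal u"
    using ex_real_w_neg w_le y_neg by (meson le_less_trans)
  obtain v where w_y: "v < 0" "w y = ereal v" using ex_real_w_neg[OF y_neg] by blast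
  have "?Q (degree a) * u \<le> ?Q (degree a) * v"
    using w_le w_x w_y by (intro mult_left_mono) auto
  also have "\<dots> < ?Q (degree b) * v"
    using one_less_card_UNIV[where 'k = 'k] rank_pos degree w_y(1)
    by (intro mult_strict_right_mono_neg power_strict_increasing) auto
  finally show ?thesis
    using w_act_neg[OF w_x(2,1), of a] w_act_neg[OF w_y(2,1) b_nonzero] degree
    by (cases "a = 0") auto
qed

end

section \<open>Successive minima of a lattice\<close>

lemma (in valued) w_le_if_lattice_abs_le:
  assumes "w x < 0" "w y < 0" "0 < s" "lattice_abs w s x \<le> lattice_abs w s y"
  shows "w y \<le> w x"
proof -
  obtain u v where w_xy: "u < 0" "w x = ereal u" "v < 0" "w y = ereal v"
    using assms(1,2) ex_real_w_neg by blast
  then have "x \<noteq> 0" "y \<noteq> 0" by auto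
  then have "(- u) powr (1 / real s) \<le> (- v) powr (1 / real s)"
    using assms(4) w_xy by (simp add: lattice_abs_def)
  then have "- u \<le> - v"
    using powr_less_mono2[of "1 / real s" "- v" "- u"] w_xy(1,3) assms(3) by force
  then show ?thesis using w_xy by simp
qed

locale lattice_minima = good_drinfeld h w K s \<rho>
  for h :: "'k::{field,finite} poly fract \<Rightarrow> 'c::field" and w K s \<rho> +
  fixes \<Lambda> :: "'c set" and r :: nat and \<omega>0 :: "nat \<Rightarrow> 'c"
  assumes subspace: "subspace \<Lambda>" and w_neg: "\<And>\<mu>. \<mu> \<in> \<Lambda> - {0} \<Longrightarrow> w \<mu> < 0"
    and minima: "lattice_SMB h w s r \<rho> \<Lambda> \<omega>0"
begin

lemma lattice_torsion_free:
  assumes "\<mu> \<in> \<Lambda>" "act a \<mu> = 0" "a \<noteq> 0"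
  shows "\<mu> = 0"
  using w_act_neg_iff[OF assms(3), of \<mu>] w_neg[of \<mu>] assms(1,2) by auto

lemma minima_in: "i \<in> {s+1..r} \<Longrightarrow> \<omega>0 i \<in> \<Lambda>"
  using minima by (auto simp: lattice_SMB_def)

lemma indep_minima: "indep_family_mod 0 {s+1..r} \<omega>0"
proof (cases "r \<in> {s+1..r}")
  case True
  then show ?thesis
    using minima by (simp add: lattice_SMB_def lin_indep_mod_iff)
qed (simp add: indep_family_mod_def)

lemma indep_minima_le: "i \<le> r \<Longrightarrow> indep_family_mod 0 {s+1..i} \<omega>0"
  by (rule indep_family_mod_subset[OF indep_minima]) auto

lemma w_minima_neg:
  assumes "i \<in> {s+1..r}"
  shows "w (\<omega>0 i) < 0"
proof -
  have "\<omega>0 i \<notin> span (\<omega>0 ` ({s+1..r} - {i}))"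
    by (rule indep_family_mod_notin_span[OF indep_minima _ assms]) auto
  then have "\<omega>0 i \<noteq> 0"
    using span_zero by metis
  then show ?thesis
    using w_neg minima_in[OF assms] by simp
qed

lemma w_le_minimum:
  assumes i_in: "i \<in> {s+1..r}" and y_in: "y \<in> \<Lambda>"
    and indep: "indep_family_mod 0 {s+1..i} (\<omega>0(i := y))"
  shows "w y \<le> w (\<omega>0 i)"
proof -
  have "y \<notin> span ((\<omega>0(i := y)) ` ({s+1..i} - {i}))"
    using indep_family_mod_notin_span[OF indep, of i] i_in by simp
  then have "y \<noteq> 0"
    using span_zero by metis
  then have "w y < 0"
    using w_neg y_in by simp
  moreover have "lattice_abs w s (\<omega>0 i) \<le> lattice_abs w s y"
    using minima i_in y_in indep by (simp add: lattice_SMB_def lin_indep_mod_iff)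
  ultimately show ?thesis
    using rank_pos by (intro w_le_if_lattice_abs_le[OF w_minima_neg[OF i_in], of y s]) auto
qed

lemma w_minima_antimono:
  assumes "j \<in> {s+1..r}" "i \<in> {s+1..r}" "j \<le> i"
  shows "w (\<omega>0 i) \<le> w (\<omega>0 j)"
proof (rule w_le_minimum[OF assms(1) minima_in[OF assms(2)]])
  have "indep_family_mod 0 {s+1..j} (\<lambda>l. \<omega>0 (if l = j then i else l))"
    by (rule indep_family_mod_comp[OF indep_minima]) (use assms in \<open>auto simp: inj_on_def\<close>)
  also have "(\<lambda>l. \<omega>0 (if l = j then i else l)) = \<omega>0(j := \<omega>0 i)"
    by auto
  finally show "indep_family_mod 0 {s+1..j} (\<omega>0(j := \<omega>0 i))" .
qed

lemma w_act_less_reduced_combination: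
  assumes a_nonzero: "a \<noteq> 0" and k_in: "k \<in> {s+1..r}" and w_y_le: "w y \<le> w (\<omega>0 k)"
    and reduced: "\<And>l. f l = 0 \<or> degree (f l) < degree a"
  shows "w (act a y) < w (\<Sum>l=s+1..k. act (f l) (\<omega>0 l))"
proof (rule w_sum_gt)
  have "w y < 0"
    using w_y_le w_minima_neg[OF k_in] by (rule le_less_trans)
  then show finite: "w (act a y) < \<infinity>"
    using w_act_neg_iff[OF a_nonzero, of y] by auto
  fix l assume l_in: "l \<in> {s+1..k}"
  then have l_in_r: "l \<in> {s+1..r}"
    using k_in by auto
  show "w (act a y) < w (act (f l) (\<omega>0 l))"
  proof (cases "f l = 0")
    case False
    moreover have "w y \<le> w (\<omega>0 l)"
      using w_y_le w_minima_antimono[OF l_in_r k_in] l_in by auto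
    ultimately show ?thesis
      using reduced[of l] w_minima_neg[OF l_in_r] by (intro w_act_less_if_degree_less) auto
  qed (use finite in simp)
qed

text \<open>Otherwise \<open>y\<close> could replace the last minimum \<open>\<omega>0 k\<close> with nonzero \<open>f k\<close>, so
  \<open>w y \<le> w (\<omega>0 k)\<close>, and the right-hand side would have larger valuation than \<open>act a y\<close>.\<close>

lemma reduced_relation_trivial:
  assumes a_nonzero: "a \<noteq> 0" and y_in: "y \<in> \<Lambda>"
    and act_y: "act a y = (\<Sum>j=s+1..r. act (f j) (\<omega>0 j))"
    and reduced: "\<And>j. f j = 0 \<or> degree (f j) < degree a" and j_in: "j \<in> {s+1..r}"
  shows "f j = 0"
proof (rule ccontr)
  let ?J = "{l \<in> {s+1..r}. f l \<noteq> 0}"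
  assume "f j \<noteq> 0"
  then have "Max ?J \<in> ?J"
    using j_in by (intro Max_in) auto
  then obtain k where k_in: "k \<in> {s+1..r}" "f k \<noteq> 0" and k_max: "Max ?J = k" by auto
  have "f l = 0" if "l \<in> {s+1..r} - {s+1..k}" for l
  proof (rule ccontr)
    assume "f l \<noteq> 0"
    then have "l \<le> k"
      unfolding k_max[symmetric] using that by (intro Max_ge) auto
    then show False using that by auto
  qed
  then have act_y_k: "act a y = (\<Sum>l=s+1..k. act (f l) (\<omega>0 l))"
    unfolding act_y using k_in by (intro sum.mono_neutral_right) auto
  have "indep_family_mod 0 {s+1..k} (\<omega>0(k := y))"
    using k_in indep_minima_le by (intro indep_family_exchange[OF _ _ _ act_y_k]) auto
  then have "w y \<le> w (\<omega>0 k)"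
    by (rule w_le_minimum[OF k_in(1) y_in])
  then have "w (act a y) < w (\<Sum>l=s+1..k. act (f l) (\<omega>0 l))"
    by (rule w_act_less_reduced_combination[OF a_nonzero k_in(1) _ reduced])
  then show False by (simp add: act_y_k)
qed

lemma dvd_if_multiple_in_lattice:
  assumes a_nonzero: "a \<noteq> 0" and y_in: "y \<in> \<Lambda>"
    and act_y: "act a y = (\<Sum>j=s+1..r. act (c j) (\<omega>0 j))"
    and j_in: "j \<in> {s+1..r}"
  shows "a dvd c j"
proof -
  let ?z = "y - (\<Sum>j=s+1..r. act (c j div a) (\<omega>0 j))"
  have "?z \<in> \<Lambda>"
    using subspace y_in minima_in by (intro subspace_diff subspace_sum subspace_scale) auto
  moreover have "act a ?z = (\<Sum>j=s+1..r. act (c j mod a) (\<omega>0 j))"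
    unfolding scale_right_diff_distrib act_y scale_sum_right scale_scale
    by (simp add: minus_mult_div_eq_mod flip: sum_subtractf scale_left_diff_distrib)
  ultimately have "c j mod a = 0"
    using degree_mod_less[OF a_nonzero]
    by (intro reduced_relation_trivial[OF a_nonzero _ _ _ j_in]) auto
  then show ?thesis by (simp add: mod_eq_0_iff_dvd)
qed

lemma saturated_span_minima:
  assumes a_nonzero: "a \<noteq> 0" and y_in: "y \<in> \<Lambda>" and I_subset: "I \<subseteq> {s+1..r}"
    and act_y_in: "act a y \<in> span (\<omega>0 ` I)"
  shows "y \<in> span (\<omega>0 ` I)"
proof -
  have finite_I: "finite I"
    using I_subset by (rule finite_subset) simp
  then obtain c where act_y: "act a y = (\<Sum>j\<in>I. act (c j) (\<omega>0 j))"
    using act_y_in by (auto simp: span_image_eq)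
  also have "\<dots> = (\<Sum>j=s+1..r. act (if j \<in> I then c j else 0) (\<omega>0 j))"
    using I_subset by (intro sum.mono_neutral_cong_left) auto
  finally have act_y_extended: "act a y = (\<Sum>j=s+1..r. act (if j \<in> I then c j else 0) (\<omega>0 j))" .
  have dvd: "a dvd c j" if "j \<in> I" for j
    using dvd_if_multiple_in_lattice[OF a_nonzero y_in act_y_extended, of j] that I_subset by auto
  let ?z = "\<Sum>j\<in>I. act (c j div a) (\<omega>0 j)"
  have "act a ?z = act a y"
    unfolding act_y scale_sum_right scale_scale using dvd by (intro sum.cong) auto
  then have "act a (y - ?z) = 0"
    by (simp add: scale_right_diff_distrib)
  moreover have "y - ?z \<in> \<Lambda>"
    using subspace y_in minima_in I_subset by (intro subspace_diff subspace_sum subspace_scale) auto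
  ultimately have "y - ?z = 0"
    using lattice_torsion_free a_nonzero by blast
  moreover have "?z \<in> span (\<omega>0 ` I)"
    by (intro span_sum span_scale span_base imageI)
  ultimately show ?thesis
    by simp
qed

lemma in_span_minima_if_w_gt:
  assumes i_in: "i \<in> {s+1..r}" and y_in: "y \<in> \<Lambda>" and less: "w (\<omega>0 i) < w y"
  shows "y \<in> span (\<omega>0 ` {s+1..<i})"
proof -
  have interval_eq: "{s+1..i} = insert i {s+1..<i}"
    using i_in by auto
  have "\<not> indep_family_mod 0 {s+1..i} (\<omega>0(i := y))"
    using w_le_minimum[OF i_in y_in] less by (auto simp: not_less)
  moreover have "indep_family_mod 0 {s+1..<i} \<omega>0"
    by (rule indep_family_mod_subset[OF indep_minima]) (use i_in in auto)
  then have "indep_family_mod 0 {s+1..<i} (\<omega>0(i := y))"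
    by (simp add: indep_family_mod_def)
  moreover have "(\<omega>0(i := y)) ` {s+1..<i} = \<omega>0 ` {s+1..<i}"
    by (intro image_cong) auto
  ultimately have "\<not> (\<forall>c. act c y \<in> span (\<omega>0 ` {s+1..<i}) \<longrightarrow> c = 0)"
    unfolding interval_eq using indep_family_insert_iff[of "{s+1..<i}" i "\<omega>0(i := y)"] by simp
  then obtain c where c_nonzero_in_span: "c \<noteq> 0" "act c y \<in> span (\<omega>0 ` {s+1..<i})"
    by blast
  then show ?thesis
    using i_in
    by (intro saturated_span_minima[OF c_nonzero_in_span(1) y_in _ c_nonzero_in_span(2)]) auto
qed

end

section \<open>Tate uniformization\<close>

context completion_at_finite_prime
begin

sublocale valued w
  by unfold_locales (rule valuation)

lemma torsion_eq_roots:
  assumes "drinfeld_module h K s \<rho>" "m \<noteq> 0"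
  shows "torsion h K \<rho> m = {x. drinfeld_act h \<rho> m x = 0}"
proof -
  interpret drinfeld h K s \<rho>
    by unfold_locales (use hom assms in auto)
  have F_closed: "0 \<in> F" "\<And>x y. x \<in> F \<Longrightarrow> y \<in> F \<Longrightarrow> x + y \<in> F \<and> x * y \<in> F"
    using subfield by (auto simp: is_subfield_def)
  have F_subset: "F \<subseteq> K"
    using subset_closure_val completion by simp
  have "coeff (drinfeld_poly h \<rho> m) i \<in> K" for i
  proof (rule coeff_drinfeld_poly_in)
    show "0 \<in> K" "range h \<subseteq> K"
      using F_closed(1) F_subset base by auto
    show "x + y \<in> K" "x * y \<in> K" if "x \<in> K" "y \<in> K" for x y
      using closure_val_add[of F x y] closure_val_mult[of F x y] F_closed(2) that completion by auto
  qed simp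
  then show ?thesis
    using rsquarefree_drinfeld_poly[OF assms(2)] by (auto simp: torsion_def sep_clos_def)
qed

end

locale tate_uniformized =
  completion_at_finite_prime h w F K + \<phi>: drinfeld h K r \<phi>
  for h :: "'k::{field,finite} poly fract \<Rightarrow> 'c::alg_closed_field" and w F K r \<phi> +
  fixes r' :: nat and \<psi> :: "'c poly" and \<Lambda> :: "'c set" and e :: "'c \<Rightarrow> 'c"
  assumes tate: "tate_uniformization h w K r r' \<phi> \<psi> \<Lambda> e"
begin

sublocale \<psi>: good_drinfeld h w K r' \<psi>
  by unfold_locales (use tate finite_prime in \<open>auto simp: tate_uniformization_def\<close>)

lemma lattice: "A_lattice h w \<psi> (r - r') \<Lambda>"
  and w_lattice_neg: "\<mu> \<in> \<Lambda> - {0} \<Longrightarrow> w \<mu> < 0"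
  and surj_e: "surj e"
  and e_eq_0_iff: "e z = 0 \<longleftrightarrow> z \<in> \<Lambda>"
  and e_act: "e (\<psi>.act a z) = \<phi>.act a (e z)"
  using tate by (auto simp: tate_uniformization_def)

lemma subspace_lattice: "\<psi>.subspace \<Lambda>"
  by (rule \<psi>.subspace_A_lattice[OF lattice])

sublocale discrete_subgroup w \<Lambda>
proof
  show "finite {\<mu> \<in> \<Lambda>. ereal R \<le> w \<mu>}" for R
    using lattice by (simp add: A_lattice_def)
qed (use subspace_lattice in \<open>auto intro: \<psi>.subspace_0 \<psi>.subspace_diff\<close>)

sublocale exp: lattice_exponential w \<Lambda> e
  by unfold_locales (use tate in \<open>auto simp: tate_uniformization_def partial_exp_def\<close>)

sublocale e: module_hom "\<psi>.act" "\<phi>.act" e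
  by unfold_locales (simp_all add: exp.add e_act)

lemma indep_if_indep_e:
  assumes "\<phi>.indep_family_mod m I (\<lambda>i. e (x i))"
  shows "\<psi>.indep_family_mod m I x"
  unfolding \<psi>.indep_family_mod_def
proof (intro allI impI)
  fix a assume "(\<Sum>i\<in>I. \<psi>.act (a i) (x i)) = 0"
  then have "(\<Sum>i\<in>I. \<phi>.act (a i) (e (x i))) = 0"
    by (simp flip: e.scale e.sum)
  then show "\<forall>i\<in>I. m dvd a i"
    using assms by (simp add: \<phi>.indep_family_mod_def)
qed

end

locale tate_SMB = tate_uniformized h w F K r \<phi> r' \<psi> \<Lambda> e
  for h :: "'k::{field,finite} poly fract \<Rightarrow> 'c::alg_closed_field" and w F K r \<phi> r' \<psi> \<Lambda> e +
  fixes m :: "'k poly" and \<omega> \<omega>0 :: "nat \<Rightarrow> 'c"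
  assumes rank_less: "r' < r" and m_nonzero: "m \<noteq> 0" and m_nonunit: "\<not> m dvd 1"
    and torsion_SMB: "torsion_SMB h w K r' \<psi> m \<omega>"
    and lattice_SMB: "lattice_SMB h w r' r \<psi> \<Lambda> \<omega>0"
    and act_\<omega>: "\<And>i. i \<in> {r'+1..r} \<Longrightarrow> \<psi>.act m (\<omega> i) = \<omega>0 i"
begin

sublocale lattice_minima h w K r' \<psi> \<Lambda> r \<omega>0
  by unfold_locales (auto simp: subspace_lattice lattice_SMB intro: w_lattice_neg)

lemma torsion_\<psi>: "torsion h K \<psi> m = {x. \<psi>.act m x = 0}"
  by (rule torsion_eq_roots[OF \<psi>.drinfeld_module m_nonzero])

lemma act_\<omega>_torsion: "i \<in> {1..r'} \<Longrightarrow> \<psi>.act m (\<omega> i) = 0"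
  using torsion_SMB by (auto simp: torsion_SMB_def torsion_\<psi>)

lemma act_\<omega>_in: "i \<in> {1..r} \<Longrightarrow> \<psi>.act m (\<omega> i) \<in> \<Lambda>"
  using act_\<omega>_torsion[of i] act_\<omega>[of i] minima_in[of i] zero_in by (cases "i \<le> r'") auto

lemma indep_\<omega>: "\<psi>.indep_family_mod m {1..r'} \<omega>"
  using torsion_SMB \<psi>.rank_pos by (auto simp: torsion_SMB_def \<psi>.lin_indep_mod_iff)

lemma act_combination_\<omega>:
  "\<psi>.act m (\<Sum>j=1..r. \<psi>.act (a j) (\<omega> j)) = (\<Sum>j=r'+1..r. \<psi>.act (a j) (\<omega>0 j))"
proof -
  have "\<psi>.act m (\<Sum>j=1..r. \<psi>.act (a j) (\<omega> j)) = (\<Sum>j=1..r. \<psi>.act (a j) (\<psi>.act m (\<omega> j)))"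
    unfolding \<psi>.scale_sum_right by (simp only: \<psi>.scale_left_commute[of m])
  also have "\<dots> = (\<Sum>j=r'+1..r. \<psi>.act (a j) (\<omega>0 j))"
    by (rule sum.mono_neutral_cong_right) (auto simp: act_\<omega> act_\<omega>_torsion simp del: \<psi>.scale_scale)
  finally show ?thesis .
qed

lemma dvd_if_combination_in_lattice:
  assumes in_lattice: "(\<Sum>j=1..r. \<psi>.act (a j) (\<omega> j)) \<in> \<Lambda>" and i_in: "i \<in> {1..r}"
  shows "m dvd a i"
proof -
  let ?lo = "\<Sum>j=1..r'. \<psi>.act (a j) (\<omega> j)" and ?hi = "\<Sum>j=r'+1..r. \<psi>.act (a j) (\<omega> j)"
  have dvd_hi: "m dvd a j" if "j \<in> {r'+1..r}" for j
    by (rule dvd_if_multiple_in_lattice[OF m_nonzero in_lattice act_combination_\<omega> that])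
  have "\<psi>.act (a j) (\<omega> j) \<in> \<Lambda>" if j_in: "j \<in> {r'+1..r}" for j
  proof -
    obtain b where "a j = b * m"
      using dvd_hi[OF j_in] by (metis dvdE mult.commute)
    then have "\<psi>.act (a j) (\<omega> j) = \<psi>.act b (\<psi>.act m (\<omega> j))"
      by simp
    then show ?thesis
      using \<psi>.subspace_scale[OF subspace_lattice act_\<omega>_in] j_in by simp
  qed
  then have "?hi \<in> \<Lambda>"
    by (rule \<psi>.subspace_sum[OF subspace_lattice])
  moreover have "{1..r} = {1..r'} \<union> {r'+1..r}"
    using rank_less by auto
  then have "(\<Sum>j=1..r. \<psi>.act (a j) (\<omega> j)) = ?lo + ?hi"
    by (simp only:) (subst sum.union_disjoint, auto)
  ultimately have "?lo \<in> \<Lambda>"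
    using diff_in[OF in_lattice] by fastforce
  moreover have "\<psi>.act m ?lo = 0"
    by (simp add: \<psi>.scale_sum_right \<psi>.scale_left_commute[of m] act_\<omega>_torsion del: \<psi>.scale_scale)
  ultimately have "?lo = 0"
    using lattice_torsion_free m_nonzero by blast
  then have "m dvd a j" if "j \<in> {1..r'}" for j
    using \<psi>.indep_family_modD[OF indep_\<omega>] that by blast
  then show ?thesis
    using dvd_hi i_in by (cases "i \<le> r'") auto
qed

lemma indep_e_\<omega>: "\<phi>.indep_family_mod m {1..r} (\<lambda>i. e (\<omega> i))"
  unfolding \<phi>.indep_family_mod_def
  using dvd_if_combination_in_lattice by (simp add: e_eq_0_iff flip: e.scale e.sum)

lemma in_span_\<omega>_if_w_gt:
  assumes i_in: "i \<in> {r'+1..r}" and act_z_in: "\<psi>.act m z \<in> \<Lambda>" and less: "w (\<omega> i) < w z"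
  shows "z \<in> \<psi>.span (\<omega> ` {1..<i})"
proof -
  have "w (\<omega> i) < 0"
    using w_minima_neg[OF i_in] \<psi>.w_act_neg_iff[OF m_nonzero, of "\<omega> i"] act_\<omega>[OF i_in] by simp
  then have "w (\<omega>0 i) < w (\<psi>.act m z)"
    using \<psi>.w_act_strict_mono[OF m_nonzero _ less] act_\<omega>[OF i_in] by simp
  then have "\<psi>.act m z \<in> \<psi>.span (\<omega>0 ` {r'+1..<i})"
    by (rule in_span_minima_if_w_gt[OF i_in act_z_in])
  then obtain b where act_z: "\<psi>.act m z = (\<Sum>j\<in>{r'+1..<i}. \<psi>.act (b j) (\<omega>0 j))"
    by (auto simp: \<psi>.span_image_eq)
  let ?y = "\<Sum>j\<in>{r'+1..<i}. \<psi>.act (b j) (\<omega> j)"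
  have "\<psi>.act m ?y = \<psi>.act m z"
    unfolding act_z using i_in
    by (simp add: \<psi>.scale_sum_right \<psi>.scale_left_commute[of m] act_\<omega> del: \<psi>.scale_scale)
  then have "\<psi>.act m (z - ?y) = 0"
    by (simp add: \<psi>.scale_right_diff_distrib)
  then have "z - ?y \<in> \<psi>.span (\<omega> ` {1..r'})"
    using \<psi>.torsion_subset_span[OF m_nonzero indep_\<omega> act_\<omega>_torsion] by blast
  moreover have "\<psi>.span (\<omega> ` {1..r'}) \<subseteq> \<psi>.span (\<omega> ` {1..<i})"
    using i_in by (intro \<psi>.span_mono image_mono) auto
  ultimately have "z - ?y \<in> \<psi>.span (\<omega> ` {1..<i})"
    by blast
  moreover have "?y \<in> \<psi>.span (\<omega> ` {1..<i})"
    by (intro \<psi>.span_sum \<psi>.span_scale \<psi>.span_base) auto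
  ultimately show ?thesis
    using \<psi>.span_add by force
qed

lemma act_eq_0_if_w_nonneg:
  assumes "\<psi>.act a z \<in> \<Lambda>" "0 \<le> w z"
  shows "\<psi>.act a z = 0"
  using w_lattice_neg[of "\<psi>.act a z"] \<psi>.w_act_nonneg[OF assms(2), of a] assms(1) by force

lemma w_le_if_indep_e:
  assumes i_in: "i \<in> {1..r}" and act_z_in: "\<psi>.act m z \<in> \<Lambda>"
    and indep: "\<phi>.indep_family_mod m {1..i} ((\<lambda>j. e (\<omega> j))(i := e z))"
  shows "w z \<le> w (\<omega> i)"
proof (rule ccontr)
  assume "\<not> w z \<le> w (\<omega> i)"
  then have less: "w (\<omega> i) < w z" by simp
  show False
  proof (cases "i \<le> r'")
    case True
    then have i_le: "i \<in> {1..r'}" using i_in by simp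
    have "0 \<le> w (\<omega> i)"
      using \<psi>.w_act_neg_iff[OF m_nonzero, of "\<omega> i"] act_\<omega>_torsion[OF i_le] by (simp add: not_less)
    then have "\<psi>.act m z = 0"
      using less act_z_in by (intro act_eq_0_if_w_nonneg) auto
    moreover have "(\<lambda>j. e (\<omega> j))(i := e z) = (\<lambda>j. e ((fun_upd \<omega> i z) j))"
      by auto
    then have "\<psi>.indep_family_mod m {1..i} (fun_upd \<omega> i z)"
      using indep indep_if_indep_e by metis
    ultimately have "w z \<le> w (\<omega> i)"
      using torsion_SMB i_le by (simp add: torsion_SMB_def torsion_\<psi> \<psi>.lin_indep_mod_iff)
    with less show False by simp
  next
    case False
    then have "z \<in> \<psi>.span (\<omega> ` {1..<i})"
      using i_in act_z_in less by (intro in_span_\<omega>_if_w_gt) auto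
    then have "e z \<in> \<phi>.span (e ` \<omega> ` {1..<i})"
      by (simp add: e.span_image)
    moreover have "((\<lambda>j. e (\<omega> j))(i := e z)) ` ({1..i} - {i}) = e ` \<omega> ` {1..<i}"
      unfolding image_image by (intro image_cong) auto
    ultimately show False
      using \<phi>.indep_family_mod_notin_span[OF indep, of i] i_in m_nonunit by simp
  qed
qed

theorem torsion_SMB_e: "torsion_SMB h w K r \<phi> m (\<lambda>i. e (\<omega> i))"
  unfolding torsion_SMB_def torsion_eq_roots[OF \<phi>.drinfeld_module m_nonzero] mem_Collect_eq
    \<phi>.lin_indep_mod_iff
proof (intro ballI conjI impI)
  fix i assume i_in: "i \<in> {1..r}"
  show "\<phi>.act m (e (\<omega> i)) = 0"
    using act_\<omega>_in[OF i_in] by (simp add: e_eq_0_iff flip: e_act)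
  show "\<phi>.indep_family_mod m {1..i} (\<lambda>i. e (\<omega> i))"
    using i_in by (intro \<phi>.indep_family_mod_subset[OF indep_e_\<omega>]) auto
  fix y assume y_torsion: "y \<in> {y. \<phi>.act m y = 0}"
    and indep: "\<phi>.indep_family_mod m {1..i} ((\<lambda>i. e (\<omega> i))(i := y))"
  obtain z l where "y = e z" "l \<in> \<Lambda>" and maximal: "coset_maximal (z - l)"
    using surj_e ex_coset_maximal by (metis surjD)
  then have y_eq: "y = e (z - l)"
    by (simp add: e.diff e_eq_0_iff[THEN iffD2])
  then have "\<psi>.act m (z - l) \<in> \<Lambda>"
    using y_torsion by (simp add: e_act flip: e_eq_0_iff)
  then have "w (z - l) \<le> w (\<omega> i)"
    using w_le_if_indep_e[OF i_in] indep y_eq by simp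
  then show "w y \<le> w (e (\<omega> i))"
    unfolding y_eq by (rule exp.w_exp_mono[OF maximal])
qed

end

theorem theorem4p1:
  fixes h :: "'k::{field,finite} poly fract \<Rightarrow> 'c::alg_closed_field"
    and w :: "'c \<Rightarrow> ereal"
    and F K \<Lambda> :: "'c set"
    and \<phi> \<psi> :: "'c poly"
    and e :: "'c \<Rightarrow> 'c"
    and u :: "'k poly"
    and r r' n :: nat
    and \<omega> \<omega>0 :: "nat \<Rightarrow> 'c"
  assumes "completion_at_finite_prime h w F K"
    and "drinfeld_module h K r \<phi>"
    and "stable_reduction CARD('k) w r \<phi> r'"
    and "1 \<le> r'" and "r' < r"
    and "tate_uniformization h w K r r' \<phi> \<psi> \<Lambda> e"
    and "lead_coeff u = 1" and "irreducible u"
    and "0 < n"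
    and "torsion_SMB h w K r' \<psi> (u ^ n) \<omega>"
    and "lattice_SMB h w r' r \<psi> \<Lambda> \<omega>0"
    and "\<And>i. i \<in> {r'+1..r} \<Longrightarrow> poly (drinfeld_poly h \<psi> (u ^ n) - [:\<omega>0 i:]) (\<omega> i) = 0"
  shows "torsion_SMB h w K r \<phi> (u ^ n) (\<lambda>i. e (\<omega> i))"
proof -
  interpret completion_at_finite_prime h w F K
    by fact
  interpret tate_uniformized h w F K r \<phi> r' \<psi> \<Lambda> e
    by unfold_locales (use hom assms(2,6) in auto)
  interpret tate_SMB h w F K r \<phi> r' \<psi> \<Lambda> e "u ^ n" \<omega> \<omega>0
  proof
    show "u ^ n \<noteq> 0" "\<not> u ^ n dvd 1"
      using assms(8,9) by (auto simp: irreducible_def is_unit_power_iff)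
    show "drinfeld_act h \<psi> (u ^ n) (\<omega> i) = \<omega>0 i" if "i \<in> {r'+1..r}" for i
      using assms(12)[OF that] by simp
  qed fact+
  show ?thesis
    by (rule torsion_SMB_e)
qed

end
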